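(* Let $(\Omega,T,\mu)$ be an invertible ergodic dynamical system, i.e. $T$ is an invertible ergodic measure-preserving transformation of a probability space $(\Omega,\mu)$. Then there exists $F\in L^2(\mu)$ (real-valued) such that the process $(F\circ T^n)_{n\in\mathbb Z}$ is absolutely continuous.
   Context: A real-valued process $X=(X_n)_{n\in I}$ indexed by a countable set $I$ is called absolutely continuous if for every finite subset $K\subset I$, with cardinality $|K|$, the joint distribution of $(X_n)_{n\in K}$ is absolutely continuous with respect to $|K|$-dimensional Lebesgue measure.
   Formalization: The formal statement additionally assumes that μ is nonatomic; without this the claim fails (e.g. on the one-point space), and if μ has an atom then every F is a.e. constant on it, so the law of F is never absolutely continuous. *)

theory Defs
  imports "HOL-Probability.Probability"
begin

text \<open>
  An invertible measure-preserving system: T is a bijection of the underlying space, measurable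
  in both directions. Outside \<open>space M\<close> the map T is unconstrained.
\<close>

locale invertible_mpt = prob_space M for M :: "'a measure" +
  fixes T :: "'a \<Rightarrow> 'a"
  assumes bij: "bij_betw T (space M) (space M)"
    and measurable_T: "T \<in> measurable M M"
    and measurable_inv: "inv_into (space M) T \<in> measurable M M"
    and preserving: "\<And>A. A \<in> sets M \<Longrightarrow> emeasure M (T -` A \<inter> space M) = emeasure M A"

locale invertible_ergodic_system = invertible_mpt +
  assumes ergodic: "\<And>A. A \<in> sets M \<Longrightarrow> T -` A \<inter> space M = A \<Longrightarrow> prob A = 0 \<or> prob A = 1"

definition nonatomic :: "'a measure \<Rightarrow> bool" where
  "nonatomic M \<longleftrightarrow>
     (\<forall>A\<in>sets M. 0 < emeasure M A \<longrightarrow>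
        (\<exists>B\<in>sets M. B \<subseteq> A \<and> 0 < emeasure M B \<and> emeasure M B < emeasure M A))"

text \<open>The integer iterates of T as a bijection of \<open>space M\<close>.\<close>

definition int_iterate :: "'a measure \<Rightarrow> ('a \<Rightarrow> 'a) \<Rightarrow> int \<Rightarrow> 'a \<Rightarrow> 'a" where
  "int_iterate M T n =
     (if 0 \<le> n then T ^^ nat n else inv_into (space M) T ^^ nat (- n))"

definition square_integrable :: "'a measure \<Rightarrow> ('a \<Rightarrow> real) \<Rightarrow> bool" where
  "square_integrable M F \<longleftrightarrow> F \<in> borel_measurable M \<and> integrable M (\<lambda>x. (F x)\<^sup>2)"

text \<open>
  The joint law of \<open>(X\<^sub>n)\<close> for n in K is a measure on the finite product of copies of the
  real line indexed by K, with the product of the Lebesgue measures as |K|-dimensional Lebesgue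
  measure; note that \<open>absolutely_continuous N P\<close> in the library means that P is absolutely
  continuous with respect to N.
\<close>

definition absolutely_continuous_process ::
    "'a measure \<Rightarrow> 'i set \<Rightarrow> ('i \<Rightarrow> 'a \<Rightarrow> real) \<Rightarrow> bool" where
  "absolutely_continuous_process M I X \<longleftrightarrow>
     countable I \<and>
     (\<forall>n\<in>I. X n \<in> borel_measurable M) \<and>
     (\<forall>K. finite K \<and> K \<subseteq> I \<longrightarrow>
        absolutely_continuous (\<Pi>\<^sub>M n\<in>K. lborel)
          (distr M (\<Pi>\<^sub>M n\<in>K. lborel) (\<lambda>x. \<lambda>n\<in>K. X n x)))"

end

theory Submission
  imports Defs
begin

text \<open>
  Pick sets \<open>A\<^sub>j\<close> of positive measure at most \<open>1/j!\<close>, let \<open>r\<^sub>j\<close> be the hitting time of \<open>A\<^sub>j\<close>, and put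
  \<open>F\<^sub>\<theta>(x) = \<Sum>\<^sub>j 2\<^sup>-\<^sup>j\<^sup>-\<^sup>1 \<theta>(j, r\<^sub>j(x))\<close> with i.i.d. uniform \<open>\<theta>\<close>; almost every \<open>\<theta>\<close> works. A law V on the d-dimensional
  cube is absolutely continuous as soon as, for infinitely many m, two independent samples of V lie in
  the same dyadic cell of side \<open>2\<^sup>-\<^sup>m\<close> with probability \<open>O(2\<^sup>-\<^sup>m\<^sup>d)\<close>. Averaging over \<open>\<theta>\<close>, and using Fatou's
  lemma in m, it suffices to bound this probability for fixed x and y and random \<open>\<theta>\<close>. If the labels
  \<open>r\<^sub>J(T\<^sup>k x)\<close> are distinct for different k, and distinct from all \<open>r\<^sub>J(T\<^sup>l y)\<close>, resampling the corresponding
  coordinates of \<open>\<theta>\<close> gives the bound \<open>(2\<^sup>J\<^sup>+\<^sup>2 2\<^sup>-\<^sup>m)\<^sup>d\<close>. Since \<open>r\<^sub>J(T\<^sup>k x) = r\<^sub>J(x) - k\<close> until the orbit hits \<open>A\<^sub>J\<close>,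
  the labels at level J fail to be distinct with probability \<open>O(1/J!)\<close>, which beats \<open>2\<^sup>J\<^sup>d\<close>.
\<close>

section \<open>Collisions of dyadic codes and absolute continuity\<close>

text \<open>A single \<open>D\<close> serves both measures, because later the same dyadic set has to
  be close to \<open>B\<close> for Lebesgue measure on a box and for the law under study.
  Approximable sets are closed under complement, which leaves the symmetric difference unchanged,
  and under countable union, where a finite subunion already carries almost all the mass.\<close>

lemma algebra_approximation:
  fixes M N :: "'b measure"
  assumes M: "finite_measure M" and N: "finite_measure N" and NM: "sets N = sets M"
    and alg: "algebra (space M) \<D>" and gen: "sets M = sigma_sets (space M) \<D>"
    and B: "B \<in> sets M" and e: "(0::real) < e"
  shows "\<exists>D\<in>\<D>. measure M ((B - D) \<union> (D - B)) < e \<and> measure N ((B - D) \<union> (D - B)) < e"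
proof -
  interpret M: finite_measure M by (rule M)
  interpret N: finite_measure N by (rule N)
  interpret algebra "space M" \<D> by (rule alg)
  have DM: "D \<in> sets M" if "D \<in> \<D>" for D
    using that gen by auto
  have sN: "space N = space M" using NM by (rule sets_eq_imp_space_eq)
  have "B \<in> sigma_sets (space M) \<D>" using B gen by simp
  then show ?thesis using e
  proof (induction arbitrary: e)
    case (Basic a)
    then show ?case by (intro bexI[of _ a]) auto
  next
    case Empty
    then show ?case by (intro bexI[of _ "{}"]) auto
  next
    case (Compl a)
    then obtain D where D: "D \<in> \<D>" "measure M ((a - D) \<union> (D - a)) < e"
      "measure N ((a - D) \<union> (D - a)) < e" by blast
    have "a \<subseteq> space M" using Compl(1) gen sets.sets_into_space by blast
    moreover have "D \<subseteq> space M" using D(1) space_closed by blast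
    ultimately have "((space M - a) - (space M - D)) \<union> ((space M - D) - (space M - a)) = (a - D) \<union> (D - a)"
      by blast
    then show ?case using D by (intro bexI[of _ "space M - D"]) auto
  next
    case (Union a)
    have aM: "a i \<in> sets M" for i using Union(1) gen by simp
    define U where "U n = (\<Union>i<n. a i)" for n
    have UM: "U n \<in> sets M" for n using aM by (auto simp: U_def)
    have UU: "(\<Union>n. U n) = (\<Union>i. a i)" by (auto simp: U_def)
    have inc: "incseq U" by (auto simp: U_def incseq_def intro: less_le_trans)
    have limM: "(\<lambda>n. measure M (U n)) \<longlonglongrightarrow> measure M (\<Union>i. a i)"
      using M.finite_Lim_measure_incseq[of U] UM inc UU by auto
    have limN: "(\<lambda>n. measure N (U n)) \<longlonglongrightarrow> measure N (\<Union>i. a i)"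
      using N.finite_Lim_measure_incseq[of U] UM inc UU NM by auto
    have "eventually (\<lambda>n. measure M (U n) > measure M (\<Union>i. a i) - e/2) sequentially"
      using limM Union(3) by (intro order_tendstoD) auto
    moreover have "eventually (\<lambda>n. measure N (U n) > measure N (\<Union>i. a i) - e/2) sequentially"
      using limN Union(3) by (intro order_tendstoD) auto
    ultimately have "eventually (\<lambda>n. measure M (U n) > measure M (\<Union>i. a i) - e/2 \<and> 
       measure N (U n) > measure N (\<Union>i. a i) - e/2) sequentially" by (rule eventually_conj)
    then obtain n where n: "measure M (U n) > measure M (\<Union>i. a i) - e/2"
       "measure N (U n) > measure N (\<Union>i. a i) - e/2"
      by (auto simp: eventually_sequentially)
    \<comment> \<open>Half of \<open>e\<close> pays for the tail of the union, the other half for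
      the \<open>n\<close> approximation errors. The \<open>+ 1\<close> keeps \<open>e'\<close>
      positive when \<open>n = 0\<close> and makes \<open>real n * e' < e/2\<close> strict.\<close>
    define e' where "e' = e / (2 * (real n + 1))"
    have e': "e' > 0" using Union(3) by (simp add: e'_def)
    have "\<forall>i. \<exists>D\<in>\<D>. measure M ((a i - D) \<union> (D - a i)) < e' \<and> measure N ((a i - D) \<union> (D - a i)) < e'"
      using Union(2)[OF e'] by blast
    then obtain D where D: "\<And>i. D i \<in> \<D>" "\<And>i. measure M ((a i - D i) \<union> (D i - a i)) < e'"
      "\<And>i. measure N ((a i - D i) \<union> (D i - a i)) < e'" by metis
    define E where "E = (\<Union>i<n. D i)"
    have E: "E \<in> \<D>" using D(1) by (auto simp: E_def)
    define A where "A = (\<Union>i. a i)"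
    have AM: "A \<in> sets M" using aM by (auto simp: A_def)
    have UA: "U n \<subseteq> A" by (auto simp: U_def A_def)
    have sub: "(A - E) \<union> (E - A) \<subseteq> (A - U n) \<union> (\<Union>i<n. (a i - D i) \<union> (D i - a i))"
      by (auto simp: E_def U_def A_def)
    have small: "real n * e' < e/2" using Union(3) by (simp add: e'_def field_simps)
    have *: "measure Q ((A - E) \<union> (E - A)) < e" 
      if Q: "finite_measure Q" "sets Q = sets M" "measure Q (U n) > measure Q A - e/2"
        "\<And>i. measure Q ((a i - D i) \<union> (D i - a i)) < e'" for Q
    proof -
      interpret Q: finite_measure Q by (rule Q)
      have "measure Q ((A - E) \<union> (E - A)) \<le> measure Q ((A - U n) \<union> (\<Union>i<n. (a i - D i) \<union> (D i - a i)))"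
        using sub AM UM DM D(1) aM Q(2) by (intro Q.finite_measure_mono) auto
      also have "\<dots> \<le> measure Q (A - U n) + measure Q (\<Union>i<n. (a i - D i) \<union> (D i - a i))"
        using AM UM DM D(1) aM Q(2) by (intro measure_Un_le) auto
      also have "measure Q (\<Union>i<n. (a i - D i) \<union> (D i - a i)) \<le> (\<Sum>i<n. measure Q ((a i - D i) \<union> (D i - a i)))"
        using DM D(1) aM Q(2) by (intro Q.finite_measure_subadditive_finite) auto
      also have "\<dots> \<le> (\<Sum>i<n. e')" using Q(4) by (intro sum_mono) (simp add: less_imp_le)
      also have "measure Q (A - U n) = measure Q A - measure Q (U n)"
        using AM UM UA Q(2) by (intro Q.finite_measure_Diff) auto
      finally show ?thesis using Q(3) small by simp
    qed
    show ?case
      using *[OF M refl] *[OF N NM] n D E by (intro bexI[of _ E]) (auto simp: A_def)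
  qed
qed

section \<open>Dyadic cells and the sigma-algebra they generate\<close>

text \<open>The index of the half-open dyadic cell of side \<open>2 ^ (- m)\<close> that contains
  \<open>v\<close>. The restriction to \<open>K\<close> places it in the countable set
  \<open>K \<rightarrow>\<^sub>E UNIV\<close>, so that lying in the same cell is equality of
  codes.\<close>

definition dyadic_code :: "'i set \<Rightarrow> nat \<Rightarrow> ('i \<Rightarrow> real) \<Rightarrow> 'i \<Rightarrow> int" where
  "dyadic_code K m v = (\<lambda>k\<in>K. \<lfloor>2 ^ m * v k\<rfloor>)"

text \<open>Taking the floor commutes with division by a positive integer, so the dyadic partitions
  are nested.\<close>

lemma dyadic_code_refine:
  "dyadic_code K m v = (\<lambda>k\<in>K. dyadic_code K (m + n) v k div 2 ^ n)"
proof -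
  have "\<lfloor>2 ^ m * x\<rfloor> = \<lfloor>2 ^ (m + n) * x\<rfloor> div 2 ^ n" for x :: real
    using floor_divide_real_eq_div[of "2 ^ n" "2 ^ (m + n) * x"] by (simp add: power_add)
  then show ?thesis by (auto simp: dyadic_code_def)
qed

lemma countable_PiE_int: "finite K \<Longrightarrow> countable (K \<rightarrow>\<^sub>E (UNIV :: int set))"
  by (intro countable_PiE) auto

lemma measurable_dyadic_code [measurable]:
  assumes "finite K"
  shows "dyadic_code K m \<in> measurable (\<Pi>\<^sub>M k\<in>K. borel) (count_space (K \<rightarrow>\<^sub>E UNIV))"
proof (rule measurable_count_space_eq_countable[THEN iffD2, OF countable_PiE_int[OF assms]], intro conjI ballI)
  show "dyadic_code K m \<in> space (\<Pi>\<^sub>M k\<in>K. borel) \<rightarrow> (K \<rightarrow>\<^sub>E UNIV)"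
    by (auto simp: dyadic_code_def)
  fix s :: "'a \<Rightarrow> int" assume s: "s \<in> K \<rightarrow>\<^sub>E UNIV"
  have "dyadic_code K m -` {s} \<inter> space (\<Pi>\<^sub>M k\<in>K. borel)
      = {v \<in> space (\<Pi>\<^sub>M k\<in>K. borel). \<forall>k\<in>K. \<lfloor>2 ^ m * v k\<rfloor> = s k}"
    using s by (auto simp: dyadic_code_def fun_eq_iff PiE_iff extensional_def)
  also have "\<dots> \<in> sets (\<Pi>\<^sub>M k\<in>K. borel)" using assms by measurable
  finally show "dyadic_code K m -` {s} \<inter> space (\<Pi>\<^sub>M k\<in>K. borel) \<in> sets (\<Pi>\<^sub>M k\<in>K. borel)" .
qed

text \<open>All cells of one set have the same level, but the level may vary from set to set. This
  gives an algebra, closed under finite unions after passing to a common level.\<close>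

definition dyadic_sets :: "'i set \<Rightarrow> ('i \<Rightarrow> real) set set" where
  "dyadic_sets K = {{v \<in> K \<rightarrow>\<^sub>E UNIV. dyadic_code K m v \<in> S} | m S. True}"

text \<open>The collision bound will be available only at infinitely many levels, so a dyadic set
  must be readable at every sufficiently fine level and not just at its own.\<close>

lemma dyadic_sets_refine:
  assumes "D \<in> dyadic_sets K"
  obtains m where "\<And>m'. m \<le> m' \<Longrightarrow> \<exists>S. D = {v \<in> K \<rightarrow>\<^sub>E UNIV. dyadic_code K m' v \<in> S}"
proof -
  obtain m S where D: "D = {v \<in> K \<rightarrow>\<^sub>E UNIV. dyadic_code K m v \<in> S}"
    using assms by (auto simp: dyadic_sets_def)
  show ?thesis
  proof (rule that[of m])
    fix m' assume "m \<le> m'"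
    then obtain n where n: "m' = m + n" using le_Suc_ex by blast
    have "D = {v \<in> K \<rightarrow>\<^sub>E UNIV. dyadic_code K m' v \<in> {s. (\<lambda>k\<in>K. s k div 2 ^ n) \<in> S}}"
      using dyadic_code_refine[of K m _ n] by (auto simp: D n)
    then show "\<exists>S. D = {v \<in> K \<rightarrow>\<^sub>E UNIV. dyadic_code K m' v \<in> S}" by blast
  qed
qed

lemma algebra_dyadic_sets: "algebra (K \<rightarrow>\<^sub>E UNIV) (dyadic_sets K)"
  unfolding algebra_iff_Un
proof (intro conjI ballI)
  show "dyadic_sets K \<subseteq> Pow (K \<rightarrow>\<^sub>E UNIV)" by (auto simp: dyadic_sets_def)
  show "{} \<in> dyadic_sets K"
    unfolding dyadic_sets_def by (rule CollectI, rule exI[of _ 0], rule exI[of _ "{}"]) auto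
  fix a assume a: "a \<in> dyadic_sets K"
  then obtain m S where m: "a = {v \<in> K \<rightarrow>\<^sub>E UNIV. dyadic_code K m v \<in> S}"
    by (auto simp: dyadic_sets_def)
  show "(K \<rightarrow>\<^sub>E UNIV) - a \<in> dyadic_sets K"
    unfolding dyadic_sets_def by (rule CollectI, rule exI[of _ m], rule exI[of _ "- S"]) (auto simp: m)
  fix b assume b: "b \<in> dyadic_sets K"
  obtain p where p: "\<And>m'. p \<le> m' \<Longrightarrow> \<exists>S. a = {v \<in> K \<rightarrow>\<^sub>E UNIV. dyadic_code K m' v \<in> S}"
    using dyadic_sets_refine[OF a] by metis
  obtain q where q: "\<And>m'. q \<le> m' \<Longrightarrow> \<exists>S. b = {v \<in> K \<rightarrow>\<^sub>E UNIV. dyadic_code K m' v \<in> S}"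
    using dyadic_sets_refine[OF b] by metis
  obtain S where S: "a = {v \<in> K \<rightarrow>\<^sub>E UNIV. dyadic_code K (p + q) v \<in> S}" using p[of "p + q"] by auto
  obtain R where R: "b = {v \<in> K \<rightarrow>\<^sub>E UNIV. dyadic_code K (p + q) v \<in> R}" using q[of "p + q"] by auto
  show "a \<union> b \<in> dyadic_sets K"
    unfolding dyadic_sets_def by (rule CollectI, rule exI[of _ "p + q"], rule exI[of _ "S \<union> R"]) (auto simp: S R)
qed

lemma dyadic_floor_tendsto: "(\<lambda>m. of_int \<lfloor>2 ^ m * x\<rfloor> / 2 ^ m) \<longlonglongrightarrow> (x :: real)"
proof (rule tendsto_sandwich[of "\<lambda>m. x - (1/2) ^ m" _ _ "\<lambda>m. x"])
  show "\<forall>\<^sub>F m in sequentially. x - (1 / 2) ^ m \<le> real_of_int \<lfloor>2 ^ m * x\<rfloor> / 2 ^ m"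
  proof (intro always_eventually allI)
    fix m :: nat
    have "2 ^ m * x - 1 \<le> of_int \<lfloor>2 ^ m * x\<rfloor>" by linarith
    then have "(2 ^ m * x - 1) / 2 ^ m \<le> of_int \<lfloor>2 ^ m * x\<rfloor> / 2 ^ m" by (rule divide_right_mono) simp
    then show "x - (1 / 2) ^ m \<le> real_of_int \<lfloor>2 ^ m * x\<rfloor> / 2 ^ m"
      by (simp add: diff_divide_distrib power_divide)
  qed
  show "\<forall>\<^sub>F m in sequentially. real_of_int \<lfloor>2 ^ m * x\<rfloor> / 2 ^ m \<le> x"
    by (intro always_eventually allI) (simp add: pos_divide_le_eq mult.commute[of x])
  have "(\<lambda>m. x - (1/2) ^ m) \<longlonglongrightarrow> x - 0"
    by (intro tendsto_diff tendsto_const LIMSEQ_power_zero) auto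
  then show "(\<lambda>m. x - (1/2) ^ m) \<longlonglongrightarrow> x" by simp
qed auto

text \<open>Each coordinate is the limit of its dyadic floors and hence measurable for the
  sigma-algebra generated by the cells. Conversely, the code is a measurable map into a countable
  set.\<close>

lemma sets_PiM_eq_dyadic:
  assumes K: "finite K"
  shows "sets (\<Pi>\<^sub>M k\<in>K. borel) = sigma_sets (K \<rightarrow>\<^sub>E UNIV) (dyadic_sets K)"
proof
  have sub: "dyadic_sets K \<subseteq> Pow (K \<rightarrow>\<^sub>E UNIV)" by (auto simp: dyadic_sets_def)
  define G where "G = sigma (K \<rightarrow>\<^sub>E UNIV) (dyadic_sets K)"
  have sG: "space G = (K \<rightarrow>\<^sub>E UNIV)" "sets G = sigma_sets (K \<rightarrow>\<^sub>E UNIV) (dyadic_sets K)"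
    using sub by (auto simp: G_def space_measure_of sets_measure_of)
  \<comment> \<open>Measurability of the identity map expresses the inclusion of the product
    sigma-algebra in that of \<open>G\<close>.\<close>
  have "(\<lambda>v. v) \<in> measurable G (\<Pi>\<^sub>M k\<in>K. borel)"
  proof (rule measurable_PiM_single')
    show "(\<lambda>v. v) \<in> space G \<rightarrow> (\<Pi>\<^sub>E k\<in>K. space borel)" by (simp add: sG)
    fix k assume k: "k \<in> K"
    have fl: "(\<lambda>v. \<lfloor>2 ^ m * v k\<rfloor>) \<in> measurable G (count_space UNIV)" for m
    proof (rule measurable_count_space_eq_countable[THEN iffD2], simp, intro conjI ballI)
      fix a :: int
      have "(\<lambda>v. \<lfloor>2 ^ m * v k\<rfloor>) -` {a} \<inter> space G = {v \<in> K \<rightarrow>\<^sub>E UNIV. dyadic_code K m v \<in> {s. s k = a}}"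
        using k by (auto simp: dyadic_code_def sG)
      then show "(\<lambda>v. \<lfloor>2 ^ m * v k\<rfloor>) -` {a} \<inter> space G \<in> sets G"
        unfolding sG dyadic_sets_def by (intro sigma_sets.Basic) blast
    qed auto
    show "(\<lambda>v. v k) \<in> borel_measurable G"
    proof (rule borel_measurable_LIMSEQ_real)
      show "(\<lambda>m. of_int \<lfloor>2 ^ m * v k\<rfloor> / 2 ^ m) \<longlonglongrightarrow> v k" for v :: "'a \<Rightarrow> real" by (rule dyadic_floor_tendsto)
      show "(\<lambda>v. of_int \<lfloor>2 ^ m * v k\<rfloor> / 2 ^ m) \<in> borel_measurable G" for m
        by (rule measurable_compose[OF fl]) simp
    qed
  qed
  then show "sets (\<Pi>\<^sub>M k\<in>K. borel) \<subseteq> sigma_sets (K \<rightarrow>\<^sub>E UNIV) (dyadic_sets K)"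
  proof (intro subsetI)
    fix B assume id: "(\<lambda>v. v) \<in> measurable G (\<Pi>\<^sub>M k\<in>K. borel)" and B: "B \<in> sets (\<Pi>\<^sub>M k\<in>K. borel :: real measure)"
    have "B \<subseteq> (K \<rightarrow>\<^sub>E UNIV)" using sets.sets_into_space[OF B] by (simp add: space_PiM)
    then show "B \<in> sigma_sets (K \<rightarrow>\<^sub>E UNIV) (dyadic_sets K)"
      using measurable_sets[OF id B] sG by (simp add: Int_absorb2)
  qed
next
  have "dyadic_sets K \<subseteq> sets (\<Pi>\<^sub>M k\<in>K. borel)"
  proof
    fix D assume "D \<in> dyadic_sets K"
    then obtain m S where D: "D = {v \<in> K \<rightarrow>\<^sub>E UNIV. dyadic_code K m v \<in> S}"
      by (auto simp: dyadic_sets_def)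
    have "D = dyadic_code K m -` (S \<inter> (K \<rightarrow>\<^sub>E UNIV)) \<inter> space (\<Pi>\<^sub>M k\<in>K. borel :: real measure)"
      by (auto simp: D space_PiM dyadic_code_def)
    also have "\<dots> \<in> sets (\<Pi>\<^sub>M k\<in>K. borel)"
      by (rule measurable_sets[OF measurable_dyadic_code[OF K]]) auto
    finally show "D \<in> sets (\<Pi>\<^sub>M k\<in>K. borel)" .
  qed
  then show "sigma_sets (K \<rightarrow>\<^sub>E UNIV) (dyadic_sets K) \<subseteq> sets (\<Pi>\<^sub>M k\<in>K. borel)"
    using sets.sigma_sets_subset[of "dyadic_sets K" "\<Pi>\<^sub>M k\<in>K. borel :: real measure"] by (simp add: space_PiM)
qed

lemma emeasure_dyadic_cell:
  assumes K: "finite K" and s: "s \<in> K \<rightarrow>\<^sub>E (UNIV :: int set)"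
  shows "emeasure (\<Pi>\<^sub>M k\<in>K. lborel) {v \<in> K \<rightarrow>\<^sub>E UNIV. dyadic_code K m v = s} = ennreal ((1/2) ^ (m * card K))"
proof -
  interpret product_sigma_finite "\<lambda>_ :: 'a. lborel :: real measure" ..
  have cell: "\<lfloor>2 ^ m * x\<rfloor> = a \<longleftrightarrow> of_int a / 2 ^ m \<le> x \<and> x < (of_int a + 1) / 2 ^ m" for x :: real and a :: int
    by (simp add: floor_eq_iff pos_divide_le_eq pos_less_divide_eq mult.commute)
  have "{v \<in> K \<rightarrow>\<^sub>E UNIV. dyadic_code K m v = s} = (\<Pi>\<^sub>E k\<in>K. {of_int (s k) / 2 ^ m ..< (of_int (s k) + 1) / 2 ^ m})"
    using s cell by (auto simp: dyadic_code_def fun_eq_iff PiE_iff extensional_def) 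
  also have "emeasure (\<Pi>\<^sub>M k\<in>K. lborel) \<dots> = (\<Prod>k\<in>K. emeasure lborel {of_int (s k) / 2 ^ m ..< (of_int (s k) + 1) / 2 ^ m :: real})"
    by (intro emeasure_PiM K) auto
  also have "\<dots> = (\<Prod>k\<in>K. ennreal ((1/2) ^ m))"
    by (intro prod.cong refl, subst emeasure_lborel_Ico)
       (auto simp: divide_right_mono diff_divide_distrib[symmetric] power_divide)
  also have "\<dots> = ennreal ((1/2) ^ (m * card K))"
    by (simp add: ennreal_power power_mult[symmetric] del: power_divide)
  finally show ?thesis .
qed

section \<open>Collision probabilities control the mass of unions of cells\<close>

text \<open>Write the probability as the sum over \<open>S\<close> of the point masses and apply
  Cauchy-Schwarz against the constant 1. The sum of the squared masses is the probability that two
  independent copies agree with a value in \<open>S\<close>.\<close>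

lemma (in prob_space) collision_cauchy_schwarz:
  assumes f: "f \<in> measurable M (count_space A)" and S: "finite S" "S \<subseteq> A"
    and A: "countable A"
  shows "(prob {x \<in> space M. f x \<in> S})\<^sup>2
    \<le> card S * measure (M \<Otimes>\<^sub>M M) {p \<in> space (M \<Otimes>\<^sub>M M). f (fst p) = f (snd p)}"
proof -
  interpret pp: pair_prob_space M M ..
  define c where "c s = {x \<in> space M. f x = s}" for s
  have cM: "c s \<in> sets M" if "s \<in> S" for s
  proof -
    have "f -` {s} \<inter> space M \<in> sets M" using f that S(2) by (intro measurable_sets[OF f]) auto
    moreover have "f -` {s} \<inter> space M = c s" by (auto simp: c_def)
    ultimately show ?thesis by simp
  qed
  have E: "{p \<in> space (M \<Otimes>\<^sub>M M). f (fst p) = f (snd p)} \<in> sets (M \<Otimes>\<^sub>M M)"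
  proof -
    have "{p \<in> space (M \<Otimes>\<^sub>M M). f (fst p) = f (snd p)} = (\<Union>a\<in>A. (f -` {a} \<inter> space M) \<times> (f -` {a} \<inter> space M))"
      using measurable_space[OF f] by (auto simp: space_pair_measure)
    also have "\<dots> \<in> sets (M \<Otimes>\<^sub>M M)"
      using A measurable_sets[OF f] by (intro sets.countable_UN' pair_measureI) auto
    finally show ?thesis .
  qed
  have "{x \<in> space M. f x \<in> S} = (\<Union>s\<in>S. c s)" by (auto simp: c_def)
  then have "prob {x \<in> space M. f x \<in> S} = (\<Sum>s\<in>S. prob (c s))"
    using cM S by (simp, intro finite_measure_finite_Union) (auto simp: disjoint_family_on_def c_def)
  then have "(prob {x \<in> space M. f x \<in> S})\<^sup>2 = (\<Sum>s\<in>S. 1 * prob (c s))\<^sup>2" by simp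
  also have "\<dots> \<le> (\<Sum>s\<in>S. 1\<^sup>2) * (\<Sum>s\<in>S. (prob (c s))\<^sup>2)" by (rule Cauchy_Schwarz_ineq_sum)
  also have "(\<Sum>s\<in>S. (prob (c s))\<^sup>2) = (\<Sum>s\<in>S. measure (M \<Otimes>\<^sub>M M) (c s \<times> c s))"
    using cM by (intro sum.cong refl) (simp add: measure_def emeasure_pair_measure_Times enn2real_mult power2_eq_square)
  also have "\<dots> = measure (M \<Otimes>\<^sub>M M) (\<Union>s\<in>S. c s \<times> c s)"
    using cM S by (intro pp.P.finite_measure_finite_Union[symmetric]) (auto simp: disjoint_family_on_def c_def)
  also have "\<dots> \<le> measure (M \<Otimes>\<^sub>M M) {p \<in> space (M \<Otimes>\<^sub>M M). f (fst p) = f (snd p)}"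
    using E by (intro pp.P.finite_measure_mono) (auto simp: c_def space_pair_measure)
  finally show ?thesis by (simp add: mult_left_mono)
qed

text \<open>A Lebesgue null set is close, for both measures, to a dyadic set of small volume. If
  that set consists of n cells of level m inside the cube, with d = \<open>card K\<close>, then n
  \<open>2 ^ (- m * d)\<close> is small, and Cauchy-Schwarz bounds the square of its mass by n times
  the collision probability, hence by \<open>C\<close> times its volume.\<close>

lemma absolutely_continuous_of_collisions:
  fixes V :: "'a \<Rightarrow> 'i \<Rightarrow> real"
  assumes M: "prob_space M" and K: "finite K" and V: "V \<in> measurable M (\<Pi>\<^sub>M k\<in>K. lborel)"
    and V01: "\<And>x k. x \<in> space M \<Longrightarrow> k \<in> K \<Longrightarrow> V x k \<in> {0..1}"
    and coll: "\<exists>\<^sub>F m in sequentially. measure (M \<Otimes>\<^sub>M M)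
        {p \<in> space (M \<Otimes>\<^sub>M M). dyadic_code K m (V (fst p)) = dyadic_code K m (V (snd p))}
        \<le> C * (1/2) ^ (m * card K)"
  shows "absolutely_continuous (\<Pi>\<^sub>M k\<in>K. lborel) (distr M (\<Pi>\<^sub>M k\<in>K. lborel) V)"
proof -
  interpret M: prob_space M by (rule M)
  interpret product_sigma_finite "\<lambda>_ :: 'i. lborel :: real measure" ..
  define L where "L = (\<Pi>\<^sub>M k\<in>K. lborel :: real measure)"
  define P where "P = distr M L V"
  have VL: "V \<in> measurable M L" using V by (simp add: L_def)
  have setsL: "sets L = sets (\<Pi>\<^sub>M k\<in>K. borel :: real measure)" unfolding L_def by (intro sets_PiM_cong) auto
  have spL: "space L = K \<rightarrow>\<^sub>E UNIV" by (simp add: L_def space_PiM)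
  have codeL: "dyadic_code K m \<in> measurable L (count_space (K \<rightarrow>\<^sub>E UNIV))" for m
    using measurable_dyadic_code[OF K, of m] setsL by (simp cong: measurable_cong_sets)
  interpret P: prob_space P unfolding P_def by (rule M.prob_space_distr[OF VL])
  \<comment> \<open>The approximation lemma needs a finite measure, so Lebesgue measure is cut down
    to a box. The side is 2 and not 1 because the value 1 is allowed for \<open>V x k\<close> and
    lies in the cell starting at 1.\<close>
  define Q where "Q = (\<Pi>\<^sub>E k\<in>K. {0..<2::real})"
  have QL: "Q \<in> sets L" unfolding Q_def L_def using K by (intro sets_PiM_I_finite) auto
  define R where "R = density L (indicator Q)"
  have eR: "emeasure R A = emeasure L (Q \<inter> A)" if "A \<in> sets L" for A
    unfolding R_def using that QL by (subst emeasure_density) (auto simp: indicator_inter_arith[symmetric] nn_integral_indicator)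
  have eQ: "emeasure L Q < \<infinity>"
  proof -
    have "emeasure L Q = (\<Prod>k\<in>K. emeasure lborel {0..<2::real})"
      unfolding Q_def L_def by (intro emeasure_PiM K) auto
    then show ?thesis by (simp add: power_less_top_ennreal)
  qed
  have fR: "finite_measure R"
  proof
    show "emeasure R (space R) \<noteq> \<infinity>"
      using eR[of "space L"] eQ QL sets.sets_into_space[OF QL] by (simp add: R_def Int_absorb2)
  qed
  interpret R: finite_measure R by (rule fR)
  have sR: "sets R = sets L" "space R = space L" by (auto simp: R_def)
  have sP: "sets P = sets L" "space P = space L" by (auto simp: P_def)
  \<comment> \<open>The term \<open>e\<close> pays for replacing \<open>B\<close> by a dyadic set
    \<open>D\<close>, and the square root is the Cauchy-Schwarz bound for the mass of
    \<open>D\<close>. Both vanish as \<open>e\<close> tends to 0.\<close>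
  have main: "measure P B \<le> e + sqrt (\<bar>C\<bar> * e)" if B: "B \<in> null_sets L" and e: "0 < e" for B e
  proof -
    have BL: "B \<in> sets L" using B by auto
    have "\<exists>D\<in>dyadic_sets K. measure R ((B - D) \<union> (D - B)) < e \<and> measure P ((B - D) \<union> (D - B)) < e"
    proof (rule algebra_approximation[OF fR _ _ _ _ _ e])
      show "algebra (space R) (dyadic_sets K)" using algebra_dyadic_sets[of K] by (simp add: sR spL)
      show "sets R = sigma_sets (space R) (dyadic_sets K)" using sets_PiM_eq_dyadic[OF K] by (simp add: sR spL setsL)
    qed (auto simp: sR sP BL P.finite_measure_axioms)
    then obtain D where D: "D \<in> dyadic_sets K" "measure R ((B - D) \<union> (D - B)) < e"
      "measure P ((B - D) \<union> (D - B)) < e" by blast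
    have DL: "D \<in> sets L"
      using D(1) sets_PiM_eq_dyadic[OF K] by (simp add: setsL sigma_sets.Basic)
    obtain m0 where m0: "\<And>m'. m0 \<le> m' \<Longrightarrow> \<exists>S. D = {v \<in> K \<rightarrow>\<^sub>E UNIV. dyadic_code K m' v \<in> S}"
      using dyadic_sets_refine[OF D(1)] by metis
    \<comment> \<open>\<open>D\<close> is a union of cells at every level from \<open>m0\<close> on,
      so one of the infinitely many good levels can be chosen among these.\<close>
    obtain m where m: "m0 \<le> m" "measure (M \<Otimes>\<^sub>M M)
        {p \<in> space (M \<Otimes>\<^sub>M M). dyadic_code K m (V (fst p)) = dyadic_code K m (V (snd p))}
        \<le> C * (1/2) ^ (m * card K)"
      using coll unfolding frequently_sequentially by blast
    obtain S' where S': "D = {v \<in> K \<rightarrow>\<^sub>E UNIV. dyadic_code K m v \<in> S'}" using m0[OF m(1)] by blast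
    \<comment> \<open>\<open>D\<close> may contain infinitely many cells. Those with indices in
      \<open>{0..2 ^ m}\<close> are finitely many, lie in \<open>Q\<close>, and carry all of the
      mass that the law gives to \<open>D\<close>.\<close>
    define S where "S = S' \<inter> (K \<rightarrow>\<^sub>E {0..2 ^ m})"
    have fS: "finite S" unfolding S_def using K by (intro finite_Int disjI2 finite_PiE) auto
    have SK: "S \<subseteq> K \<rightarrow>\<^sub>E UNIV" by (auto simp: S_def)
    define E where "E = {v \<in> K \<rightarrow>\<^sub>E UNIV. dyadic_code K m v \<in> S}"
    have cellL: "{v \<in> K \<rightarrow>\<^sub>E UNIV. dyadic_code K m v = s} \<in> sets L" if "s \<in> S" for s
    proof -
      have "{v \<in> K \<rightarrow>\<^sub>E UNIV. dyadic_code K m v = s} = dyadic_code K m -` {s} \<inter> space L" by (auto simp: spL)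
      then show ?thesis using that SK by (simp) (intro measurable_sets[OF codeL], auto)
    qed
    have EU: "E = (\<Union>s\<in>S. {v \<in> K \<rightarrow>\<^sub>E UNIV. dyadic_code K m v = s})" by (auto simp: E_def)
    have EL: "E \<in> sets L" unfolding EU using cellL fS by auto
    have "emeasure L E = (\<Sum>s\<in>S. emeasure L {v \<in> K \<rightarrow>\<^sub>E UNIV. dyadic_code K m v = s})"
      unfolding EU using cellL fS by (intro sum_emeasure[symmetric]) (auto simp: disjoint_family_on_def)
    also have "\<dots> = (\<Sum>s\<in>S. ennreal ((1/2) ^ (m * card K)))"
      unfolding L_def using SK by (intro sum.cong refl emeasure_dyadic_cell K) auto
    also have "\<dots> = ennreal (card S * (1/2) ^ (m * card K))"
      by (simp add: ennreal_mult ennreal_of_nat_eq_real_of_nat)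
    finally have LE: "emeasure L E = ennreal (card S * (1/2) ^ (m * card K))" .
    have EQ: "E \<subseteq> Q"
    proof
      fix v assume v: "v \<in> E"
      have "v k \<in> {0..<2}" if k: "k \<in> K" for k
      proof -
        have "\<lfloor>2 ^ m * v k\<rfloor> \<in> {0..2 ^ m}" using v k by (auto simp: E_def S_def dyadic_code_def PiE_iff)
        then have *: "0 \<le> 2 ^ m * v k" "2 ^ m * v k < 2 ^ m + 1" 
          by (auto simp: le_floor_iff floor_le_iff)
        have "(1::real) \<le> 2 ^ m" by simp
        then have "2 ^ m * v k < 2 ^ m * 2" using *(2) by linarith
        moreover have "0 \<le> v k" using mult_le_cancel_left_pos[of "2 ^ m" 0 "v k"] *(1) by simp
        ultimately show ?thesis by simp
      qed
      then show "v \<in> Q" using v by (auto simp: Q_def E_def PiE_iff)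
    qed
    have ED: "E \<subseteq> D" by (auto simp: E_def S' S_def)
    have "emeasure L (Q \<inter> B) = 0" using null_set_Int1[OF B QL] by (simp add: Int_commute null_setsD1)
    then have RB: "measure R B = 0" using eR[OF BL] by (simp add: measure_def)
    have "measure R E \<le> measure R (B \<union> ((B - D) \<union> (D - B)))"
      using ED DL BL by (intro R.finite_measure_mono) (auto simp: sR)
    also have "\<dots> \<le> measure R B + measure R ((B - D) \<union> (D - B))"
      using DL BL by (intro measure_Un_le) (auto simp: sR)
    finally have "measure R E < e" using RB D(2) by simp
    moreover have "measure R E = card S * (1/2) ^ (m * card K)"
      using eR[OF EL] LE EQ by (simp add: Int_absorb1 measure_def)
    ultimately have cS: "card S * (1/2) ^ (m * card K) < e" by simp
    have fm: "(\<lambda>x. dyadic_code K m (V x)) \<in> measurable M (count_space (K \<rightarrow>\<^sub>E UNIV))"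
      by (rule measurable_compose[OF VL codeL])
    have "measure P D = measure P E"
    proof -
      have "V -` D \<inter> space M = V -` E \<inter> space M"
      proof (intro set_eqI iffI)
        fix x assume x: "x \<in> V -` D \<inter> space M"
        have "dyadic_code K m (V x) \<in> K \<rightarrow>\<^sub>E {0..2 ^ m}"
        proof -
          have "\<lfloor>2 ^ m * V x k\<rfloor> \<in> {0..2 ^ m}" if "k \<in> K" for k
          proof -
            have "0 \<le> V x k" "V x k \<le> 1" using V01[of x k] x that by auto
            then have "0 \<le> 2 ^ m * V x k" "2 ^ m * V x k \<le> 2 ^ m * 1" by (auto intro: mult_left_mono)
            then have "0 \<le> 2 ^ m * V x k" "2 ^ m * V x k < 2 ^ m + 1" by linarith+
            then show ?thesis by (simp add: le_floor_iff floor_le_iff)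
          qed
          then show ?thesis by (auto simp: dyadic_code_def)
        qed
        then show "x \<in> V -` E \<inter> space M" using x by (auto simp: S' E_def S_def)
      qed (use ED in auto)
      then show ?thesis unfolding P_def using VL DL EL by (simp add: measure_distr)
    qed
    also have "\<dots> = measure M {x \<in> space M. dyadic_code K m (V x) \<in> S}"
      unfolding P_def using VL EL measurable_space[OF VL]
      by (subst measure_distr) (auto simp: E_def spL intro!: arg_cong[where f = "measure M"])
    finally have PD: "measure P D = measure M {x \<in> space M. dyadic_code K m (V x) \<in> S}" .
    have "(measure P D)\<^sup>2 \<le> card S * measure (M \<Otimes>\<^sub>M M)
        {p \<in> space (M \<Otimes>\<^sub>M M). dyadic_code K m (V (fst p)) = dyadic_code K m (V (snd p))}"
      unfolding PD by (rule M.collision_cauchy_schwarz[OF fm fS SK countable_PiE_int[OF K]])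
    also have "\<dots> \<le> card S * (C * (1/2) ^ (m * card K))" using m(2) by (intro mult_left_mono) auto
    also have "\<dots> = C * (card S * (1/2) ^ (m * card K))" by simp
    also have "\<dots> \<le> \<bar>C\<bar> * (card S * (1/2) ^ (m * card K))" by (intro mult_right_mono) auto
    also have "\<dots> \<le> \<bar>C\<bar> * e" using cS by (intro mult_left_mono) auto
    finally have "measure P D \<le> sqrt (\<bar>C\<bar> * e)" by (rule real_le_rsqrt)
    moreover have "measure P B \<le> measure P D + measure P ((B - D) \<union> (D - B))"
    proof -
      have "measure P B \<le> measure P (D \<union> ((B - D) \<union> (D - B)))"
        using DL BL by (intro P.finite_measure_mono) (auto simp: sP)
      also have "\<dots> \<le> measure P D + measure P ((B - D) \<union> (D - B))"
        using DL BL by (intro measure_Un_le) (auto simp: sP)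
      finally show ?thesis .
    qed
    ultimately show ?thesis using D(3) by simp
  qed
  have "null_sets L \<subseteq> null_sets P"
  proof
    fix B assume B: "B \<in> null_sets L"
    have "((\<lambda>e. e + sqrt (\<bar>C\<bar> * e)) \<longlongrightarrow> 0 + sqrt (\<bar>C\<bar> * 0)) (at_right 0)"
      by (intro tendsto_intros)
    then have "measure P B \<le> 0 + sqrt (\<bar>C\<bar> * 0)"
      by (rule tendsto_lowerbound) (auto simp: eventually_at_filter main[OF B])
    then have "measure P B = 0" using measure_nonneg[of P B] by simp
    then show "B \<in> null_sets P" using B by (auto simp: sP P.emeasure_eq_measure null_sets_def)
  qed
  then show ?thesis by (simp add: absolutely_continuous_def L_def P_def)
qed

section \<open>Independent uniform noise\<close>

abbreviation uniform_unit :: "real measure" where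
  "uniform_unit \<equiv> uniform_measure lborel {0..1}"

text \<open>Indexing by the whole type makes every function a point of the space, so that an update
  \<open>\<theta>(i := t)\<close> never leaves it.\<close>

abbreviation noise :: "('i \<Rightarrow> real) measure" where
  "noise \<equiv> \<Pi>\<^sub>M i\<in>UNIV. uniform_unit"

lemma prob_space_uniform_unit: "prob_space uniform_unit"
  by (rule prob_space_uniform_measure) auto

lemma prob_space_noise: "prob_space (\<Pi>\<^sub>M i\<in>I. uniform_unit)"
  by (rule prob_space_PiM) (rule prob_space_uniform_unit)

text \<open>By Fubini, coordinate \<open>i\<close> can be integrated first with all the others
  fixed. Since \<open>B\<close> ignores this coordinate, its section is everything or empty, while
  the section of \<open>A\<close> has probability at most \<open>c\<close>.\<close>

lemma resampling:
  fixes i :: 'i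
  assumes A: "A \<in> sets noise"
    and B: "B \<in> sets noise"
    and indep: "\<And>\<theta> t. \<theta>(i := t) \<in> B \<longleftrightarrow> \<theta> \<in> B"
    and bound: "\<And>\<theta>. emeasure uniform_unit {t. \<theta>(i := t) \<in> A} \<le> c"
  shows "emeasure noise (A \<inter> B)
    \<le> c * emeasure noise B"
proof -
  define J where "J = (UNIV :: 'i set) - {i}"
  interpret U: prob_space uniform_unit by (rule prob_space_uniform_unit)
  define N where "N = (\<Pi>\<^sub>M i\<in>J. uniform_unit)"
  interpret N: prob_space N unfolding N_def by (rule prob_space_noise)
  interpret UN: pair_prob_space uniform_unit N ..
  have J: "insert i J = UNIV" by (auto simp: J_def)
  \<comment> \<open>Inserting an independent uniform value at \<open>i\<close> into noise on the
    remaining indices reproduces the noise.\<close>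
  have D: "distr (uniform_unit \<Otimes>\<^sub>M N) noise (\<lambda>(x, X). X(i := x)) = noise"
    using distr_pair_PiM_eq_PiM[of J "\<lambda>_. uniform_unit" i] prob_space_uniform_unit J unfolding N_def by simp
  have mm: "(\<lambda>(x, X). X(i := x)) \<in> measurable (uniform_unit \<Otimes>\<^sub>M N) noise"
  proof -
    have swap: "(\<lambda>(x, X). (X, x)) \<in> measurable (uniform_unit \<Otimes>\<^sub>M N) (N \<Otimes>\<^sub>M uniform_unit)"
      by (rule measurable_pair_swap')
    have "(\<lambda>(X, x). X(i := x)) \<in> measurable (N \<Otimes>\<^sub>M uniform_unit) (\<Pi>\<^sub>M i\<in>insert i J. uniform_unit)"
      unfolding N_def by (rule measurable_add_dim)
    from measurable_compose[OF swap this] show ?thesis unfolding J by (simp only: split_beta' fst_conv snd_conv)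
  qed
  have E: "emeasure noise S
      = (\<integral>\<^sup>+X. emeasure uniform_unit {t. X(i := t) \<in> S} \<partial>N)"
    if S: "S \<in> sets noise" for S
  proof -
    have "emeasure noise S
        = emeasure (uniform_unit \<Otimes>\<^sub>M N) ((\<lambda>(x, X). X(i := x)) -` S \<inter> space (uniform_unit \<Otimes>\<^sub>M N))"
      by (subst D[symmetric], subst emeasure_distr[OF mm S]) simp
    also have "\<dots> = (\<integral>\<^sup>+X. emeasure uniform_unit ((\<lambda>x. (x, X)) -` ((\<lambda>(x, X). X(i := x)) -` S \<inter> space (uniform_unit \<Otimes>\<^sub>M N))) \<partial>N)"
      by (rule UN.emeasure_pair_measure_alt2[OF measurable_sets[OF mm S]])
    also have "\<dots> = (\<integral>\<^sup>+X. emeasure uniform_unit {t. X(i := t) \<in> S} \<partial>N)"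
      by (intro nn_integral_cong arg_cong[where f = "emeasure uniform_unit"]) (auto simp: space_pair_measure)
    finally show ?thesis .
  qed
  have Bi: "{t. X(i := t) \<in> B} = (if X \<in> B then UNIV else {})" for X using indep by auto
  have U1: "emeasure uniform_unit UNIV = 1" using U.emeasure_space_1 by simp
  have "emeasure noise (A \<inter> B)
      = (\<integral>\<^sup>+X. emeasure uniform_unit {t. X(i := t) \<in> A \<inter> B} \<partial>N)"
    using A B by (intro E) auto
  also have "\<dots> \<le> (\<integral>\<^sup>+X. c * emeasure uniform_unit {t. X(i := t) \<in> B} \<partial>N)"
    by (intro nn_integral_mono) (auto simp: indep Bi U1 bound)
  also have "\<dots> = c * (\<integral>\<^sup>+X. emeasure uniform_unit {t. X(i := t) \<in> B} \<partial>N)"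
  proof (rule nn_integral_cmult)
    have "(\<lambda>X. emeasure uniform_unit ((\<lambda>x. (x, X)) -` ((\<lambda>(x, X). X(i := x)) -` B \<inter> space (uniform_unit \<Otimes>\<^sub>M N)))) \<in> borel_measurable N"
      by (rule UN.measurable_emeasure_Pair2[OF measurable_sets[OF mm B]])
    also have "?this \<longleftrightarrow> (\<lambda>X. emeasure uniform_unit {t. X(i := t) \<in> B}) \<in> borel_measurable N"
      by (intro measurable_cong arg_cong[where f = "emeasure uniform_unit"]) (auto simp: space_pair_measure)
    finally show "(\<lambda>X. emeasure uniform_unit {t. X(i := t) \<in> B}) \<in> borel_measurable N" .
  qed
  also have "\<dots> = c * emeasure noise B" by (simp add: E[OF B])
  finally show ?thesis .
qed

lemma emeasure_uniform_unit_window: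
  assumes c: "c > 0" and \<epsilon>: "\<epsilon> \<ge> 0"
  shows "emeasure uniform_unit {t. \<bar>c * t + g\<bar> < \<epsilon>} \<le> ennreal (2 * \<epsilon> / c)"
proof -
  have "{t. \<bar>c * t + g\<bar> < \<epsilon>} \<in> sets lborel" by measurable
  then have "emeasure uniform_unit {t. \<bar>c * t + g\<bar> < \<epsilon>} = emeasure lborel ({0..1} \<inter> {t. \<bar>c * t + g\<bar> < \<epsilon>})"
    by (subst emeasure_uniform_measure) (auto simp: divide_ennreal_def)
  also have "\<dots> \<le> emeasure lborel {(- \<epsilon> - g) / c .. (\<epsilon> - g) / c}"
    using c by (intro emeasure_mono) (auto simp: pos_divide_le_eq pos_le_divide_eq abs_less_iff mult.commute)
  also have "\<dots> = ennreal (2 * \<epsilon> / c)"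
    using c \<epsilon> by (subst emeasure_lborel_Icc) (auto simp: divide_right_mono diff_divide_distrib[symmetric])
  finally show ?thesis .
qed

text \<open>The coordinates \<open>a k\<close> are distinct and no \<open>G k\<close> reads any of
  them, so they can be resampled one after the other. Each confines a uniform variable to an
  interval of length \<open>2 * \<epsilon> / c\<close>. The functions \<open>G k\<close> may depend
  on the rest of the noise in any way.\<close>

lemma small_ball_independent:
  fixes a :: "'k \<Rightarrow> 'i" and G :: "'k \<Rightarrow> ('i \<Rightarrow> real) \<Rightarrow> real"
  assumes K: "finite K" and a: "inj_on a K" and c: "c > 0" and \<epsilon>: "\<epsilon> \<ge> 0"
    and G: "\<And>k. k \<in> K \<Longrightarrow> G k \<in> borel_measurable noise"
    and indep: "\<And>k l \<theta> t. k \<in> K \<Longrightarrow> l \<in> K \<Longrightarrow> G k (\<theta>(a l := t)) = G k \<theta>"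
  shows "emeasure noise {\<theta>. \<forall>k\<in>K. \<bar>c * \<theta> (a k) + G k \<theta>\<bar> < \<epsilon>}
    \<le> ennreal (2 * \<epsilon> / c) ^ card K"
  using K a G indep
proof (induction K rule: finite_induct)
  case empty
  interpret prob_space "noise :: ('i \<Rightarrow> real) measure" by (rule prob_space_noise)
  show ?case using emeasure_space_1 by (simp add: space_PiM)
next
  case (insert l K)
  let ?N = "noise :: ('i \<Rightarrow> real) measure"
  have sp: "space ?N = UNIV" by (simp add: space_PiM PiE_def)
  have [measurable]: "G k \<in> borel_measurable ?N" if "k \<in> insert l K" for k using insert(5) that by blast
  have cm [measurable]: "(\<lambda>\<theta>. \<theta> i) \<in> borel_measurable ?N" for i
    using measurable_component_singleton[of i UNIV "\<lambda>_. uniform_unit"] by (simp cong: measurable_cong_sets)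
  define A where "A = {\<theta>. \<bar>c * \<theta> (a l) + G l \<theta>\<bar> < \<epsilon>}"
  define B where "B = {\<theta>. \<forall>k\<in>K. \<bar>c * \<theta> (a k) + G k \<theta>\<bar> < \<epsilon>}"
  have "{\<theta> \<in> space ?N. \<bar>c * \<theta> (a l) + G l \<theta>\<bar> < \<epsilon>} \<in> sets ?N" by measurable
  then have A: "A \<in> sets ?N" by (simp add: A_def sp)
  have "{\<theta> \<in> space ?N. \<forall>k\<in>K. \<bar>c * \<theta> (a k) + G k \<theta>\<bar> < \<epsilon>} \<in> sets ?N"
    using insert(1) by measurable
  then have B: "B \<in> sets ?N" by (simp add: B_def sp)
  have al: "a k \<noteq> a l" if "k \<in> K" for k using insert(2,4) that by (auto simp: inj_on_def)
  have "emeasure ?N (A \<inter> B) \<le> ennreal (2 * \<epsilon> / c) * emeasure ?N B"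
  proof (rule resampling[OF A B])
    show "\<theta>(a l := t) \<in> B \<longleftrightarrow> \<theta> \<in> B" for \<theta> t
      using insert(6)[of _ l] al by (simp add: B_def del: fun_upd_apply) (simp add: fun_upd_other)
    show "emeasure uniform_unit {t. \<theta>(a l := t) \<in> A} \<le> ennreal (2 * \<epsilon> / c)" for \<theta>
    proof -
      have "{t. \<theta>(a l := t) \<in> A} = {t. \<bar>c * t + G l \<theta>\<bar> < \<epsilon>}"
        unfolding A_def mem_Collect_eq insert(6)[of l l, OF insertI1 insertI1] by simp
      then show ?thesis using emeasure_uniform_unit_window[OF c \<epsilon>, of "G l \<theta>"] by (simp only:)
    qed
  qed
  also have "emeasure ?N B \<le> ennreal (2 * \<epsilon> / c) ^ card K"
    unfolding B_def using insert by (intro insert.IH) (auto simp: inj_on_def)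
  finally have "emeasure ?N (A \<inter> B) \<le> ennreal (2 * \<epsilon> / c) * ennreal (2 * \<epsilon> / c) ^ card K"
    by (simp add: mult_left_mono)
  moreover have "{\<theta>. \<forall>k\<in>insert l K. \<bar>c * \<theta> (a k) + G k \<theta>\<bar> < \<epsilon>} = A \<inter> B" by (auto simp: A_def B_def)
  ultimately show ?case using insert(1,2) by simp
qed

text \<open>The noise lies in the unit interval only almost surely; clipping makes the series
  converge for every \<open>\<theta>\<close>.\<close>

definition clip :: "real \<Rightarrow> real" where
  "clip t = max 0 (min 1 t)"

lemma clip_bounds [simp]: "0 \<le> clip t" "clip t \<le> 1" "\<bar>clip t\<bar> \<le> 1"
  by (auto simp: clip_def)

lemma measurable_clip [measurable]: "clip \<in> borel_measurable borel"
  unfolding clip_def by measurable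

text \<open>The label \<open>r j\<close> selects which noise variable of level \<open>j\<close> is
  read. Two label sequences that differ at one level therefore read independent variables
  there.\<close>

definition noise_series :: "(nat \<times> nat \<Rightarrow> real) \<Rightarrow> (nat \<Rightarrow> nat) \<Rightarrow> real" where
  "noise_series \<theta> r = (\<Sum>j. (1/2) ^ Suc j * clip (\<theta> (j, r j)))"

lemma summable_dyadic_clip: "summable (\<lambda>j. (1/2) ^ Suc j * clip (u j))"
  by (rule summable_comparison_test'[of "\<lambda>j. (1/2) ^ Suc j" 0])
     (use sums_summable[OF power_half_series] in \<open>auto simp: abs_mult intro: mult_left_le\<close>)

lemma noise_series_bounds: "0 \<le> noise_series \<theta> r" "noise_series \<theta> r \<le> 1"
proof -
  show "0 \<le> noise_series \<theta> r" unfolding noise_series_def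
    by (intro suminf_nonneg summable_dyadic_clip) auto
  have "noise_series \<theta> r \<le> (\<Sum>j. (1/2) ^ Suc j)" unfolding noise_series_def
    using summable_dyadic_clip sums_summable[OF power_half_series]
    by (intro suminf_le) (auto intro: mult_left_le)
  then show "noise_series \<theta> r \<le> 1" using sums_unique[OF power_half_series] by simp
qed

lemma measurable_noise_component [measurable]: "(\<lambda>\<theta>. \<theta> i) \<in> borel_measurable noise"
  using measurable_component_singleton[of i UNIV "\<lambda>_. uniform_unit"] by (simp cong: measurable_cong_sets)

lemma space_noise: "space noise = UNIV"
  by (simp add: space_PiM PiE_def)

lemma AE_noise_clip: "AE \<theta> in (noise :: ('i::countable \<Rightarrow> real) measure). \<forall>i. clip (\<theta> i) = \<theta> i"
  unfolding AE_all_countable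
proof
  fix i :: 'i
  have "AE t in uniform_unit. clip t = t"
    by (rule AE_uniform_measureI) (auto simp: clip_def)
  then have "AE t in distr noise uniform_unit (\<lambda>\<theta>. \<theta> i). clip t = t"
    by (subst distr_PiM_component) (auto intro: prob_space_uniform_unit)
  moreover have "(\<lambda>\<theta>. \<theta> i) \<in> measurable noise uniform_unit" 
    using measurable_component_singleton[of i UNIV "\<lambda>_. uniform_unit"] by simp
  ultimately show "AE \<theta> in (noise :: ('i \<Rightarrow> real) measure). clip (\<theta> i) = \<theta> i"
    by (subst (asm) AE_distr_iff) (auto simp: clip_def)
qed

text \<open>Only level \<open>J\<close> is used: its term in the series along \<open>a k\<close> is
  kept apart, and everything else goes into \<open>G k\<close>. The hypotheses on the labels say
  that the isolated variables are distinct and occur in no \<open>G k\<close>, so the small ball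
  estimate applies with \<open>c = (1/2) ^ Suc J\<close>.\<close>

lemma noise_series_collision:
  fixes a b :: "'k \<Rightarrow> nat \<Rightarrow> nat"
  assumes K: "finite K" and inj: "inj_on (\<lambda>k. a k J) K"
    and disj: "\<And>k l. k \<in> K \<Longrightarrow> l \<in> K \<Longrightarrow> a l J \<noteq> b k J" and \<epsilon>: "\<epsilon> \<ge> 0"
  shows "emeasure noise {\<theta>. \<forall>k\<in>K. \<bar>noise_series \<theta> (a k) - noise_series \<theta> (b k)\<bar> < \<epsilon>}
    \<le> ennreal (2 * \<epsilon> * 2 ^ Suc J) ^ card K"
proof -
  \<comment> \<open>The weights of the series with level \<open>J\<close> removed. The series along
    \<open>b k\<close> is kept whole, since it never reads an isolated variable.\<close>
  define w where "w j = (if j = J then 0 else (1/2) ^ Suc j :: real)" for j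
  define G where "G k \<theta> = (\<Sum>j. w j * clip (\<theta> (j, a k j))) - noise_series \<theta> (b k)" for k \<theta>
  have meas [measurable]: "(\<lambda>\<theta>. noise_series \<theta> r) \<in> borel_measurable noise" for r
    unfolding noise_series_def by measurable
  have G [measurable]: "G k \<in> borel_measurable noise" for k
    unfolding G_def by measurable
  have split: "noise_series \<theta> (a k) - noise_series \<theta> (b k) = (1/2) ^ Suc J * \<theta> (J, a k J) + G k \<theta>"
    if "\<forall>i. clip (\<theta> i) = \<theta> i" for \<theta> k
  proof -
    let ?f = "\<lambda>j. (1/2) ^ Suc j * clip (\<theta> (j, a k j))"
    have "(\<lambda>j. if j = J then ?f j else 0) sums ?f J" by (rule sums_single)
    then have "(\<lambda>j. ?f j - (if j = J then ?f j else 0)) sums (noise_series \<theta> (a k) - ?f J)"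
      unfolding noise_series_def by (intro sums_diff summable_sums summable_dyadic_clip)
    also have "(\<lambda>j. ?f j - (if j = J then ?f j else 0)) = (\<lambda>j. w j * clip (\<theta> (j, a k j)))"
      by (auto simp: w_def fun_eq_iff)
    finally show ?thesis using that by (simp add: G_def sums_iff)
  qed
  have "{\<theta> \<in> space noise. \<forall>k\<in>K. \<bar>(1/2) ^ Suc J * \<theta> (J, a k J) + G k \<theta>\<bar> < \<epsilon>} \<in> sets noise"
    using K by measurable
  then have "emeasure noise {\<theta>. \<forall>k\<in>K. \<bar>noise_series \<theta> (a k) - noise_series \<theta> (b k)\<bar> < \<epsilon>}
    \<le> emeasure noise {\<theta>. \<forall>k\<in>K. \<bar>(1/2) ^ Suc J * \<theta> (J, a k J) + G k \<theta>\<bar> < \<epsilon>}"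
    using AE_noise_clip split by (intro emeasure_mono_AE) (auto elim!: eventually_mono simp: space_noise simp del: power_Suc)
  also have "\<dots> \<le> ennreal (2 * \<epsilon> / (1/2) ^ Suc J) ^ card K"
  proof (rule small_ball_independent[OF K _ _ \<epsilon> G])
    show "inj_on (\<lambda>k. (J, a k J)) K" using inj by (auto simp: inj_on_def)
    fix k l \<theta> t assume "k \<in> K" "l \<in> K"
    then have "noise_series (\<theta>((J, a l J) := t)) (b k) = noise_series \<theta> (b k)"
      unfolding noise_series_def using disj[of k l] by (intro suminf_cong) auto
    moreover have "(\<Sum>j. w j * clip ((\<theta>((J, a l J) := t)) (j, a k j))) = (\<Sum>j. w j * clip (\<theta> (j, a k j)))"
      by (intro suminf_cong) (auto simp: w_def)
    ultimately show "G k (\<theta>((J, a l J) := t)) = G k \<theta>" by (simp add: G_def)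
  qed auto
  also have "2 * \<epsilon> / (1/2) ^ Suc J = 2 * \<epsilon> * 2 ^ Suc J" by (simp add: power_divide)
  finally show ?thesis .
qed

section \<open>Hitting times\<close>

text \<open>A subset of strictly smaller positive measure splits a set into two pieces of positive
  measure, one of which has at most half of the mass. Iterating the halving gives arbitrarily small
  sets.\<close>

lemma (in prob_space) nonatomic_small_set:
  assumes "nonatomic M" and "0 < (\<epsilon> :: real)"
  obtains A where "A \<in> sets M" "0 < emeasure M A" "emeasure M A \<le> ennreal \<epsilon>"
proof -
  have halving: "\<exists>A\<in>sets M. 0 < prob A \<and> prob A \<le> (1/2) ^ n" for n
  proof (induction n)
    case 0
    show ?case by (intro bexI[of _ "space M"]) (auto simp: prob_space)
  next
    case (Suc n)
    then obtain A where A: "A \<in> sets M" "0 < prob A" "prob A \<le> (1/2) ^ n" by blast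
    then obtain B where B: "B \<in> sets M" "B \<subseteq> A" "0 < prob B" "prob B < prob A"
      using assms(1) unfolding nonatomic_def emeasure_eq_measure by (auto simp: ennreal_less_iff)
    have D: "prob (A - B) = prob A - prob B" using A B by (intro finite_measure_Diff) auto
    show ?case
    proof (cases "prob B \<le> prob A / 2")
      case True
      then show ?thesis using A B by (intro bexI[of _ B]) auto
    next
      case False
      then show ?thesis using A B D by (intro bexI[of _ "A - B"]) auto
    qed
  qed
  obtain n where n: "(1/2::real) ^ n < \<epsilon>" using real_arch_pow_inv[OF assms(2), of "1/2"] by auto
  obtain A where "A \<in> sets M" "0 < prob A" "prob A \<le> (1/2) ^ n" using halving[of n] by blast
  then show ?thesis using n by (intro that[of A]) (auto simp: emeasure_eq_measure)
qed

text \<open>Counting starts at 0, so points of \<open>A\<close> have hitting time 0. On orbits that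
  never meet \<open>A\<close> the value is unspecified, which is why later bounds use that almost
  every orbit hits.\<close>

definition hitting_time :: "('a \<Rightarrow> 'a) \<Rightarrow> 'a set \<Rightarrow> 'a \<Rightarrow> nat" where
  "hitting_time T A x = (LEAST n. (T ^^ n) x \<in> A)"

text \<open>Up to the first visit, each step of the orbit lowers the waiting time by exactly one.
  This is what makes the labels along an orbit distinct.\<close>

lemma hitting_time_iterate:
  assumes "(T ^^ n) x \<in> A" "p \<le> hitting_time T A x"
  shows "hitting_time T A ((T ^^ p) x) = hitting_time T A x - p"
  unfolding hitting_time_def
proof (rule Least_equality)
  have add: "(T ^^ q) ((T ^^ p) x) = (T ^^ (q + p)) x" for q by (simp add: funpow_add)
  have "(T ^^ hitting_time T A x) x \<in> A" unfolding hitting_time_def by (rule LeastI[of _ n]) (rule assms(1))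
  then show "(T ^^ ((LEAST n. (T ^^ n) x \<in> A) - p)) ((T ^^ p) x) \<in> A"
    using assms(2) by (simp add: add hitting_time_def)
  fix q assume "(T ^^ q) ((T ^^ p) x) \<in> A"
  then have "(LEAST n. (T ^^ n) x \<in> A) \<le> q + p" unfolding add by (rule Least_le)
  then show "(LEAST n. (T ^^ n) x \<in> A) - p \<le> q" by simp
qed

section \<open>Iterates of a measure-preserving map\<close>

context invertible_mpt
begin

lemma measurable_funpow: "T ^^ n \<in> measurable M M"
proof (induction n)
  case (Suc n)
  show ?case using measurable_comp[OF Suc measurable_T] by (simp add: o_def)
qed (simp add: id_def)

lemma emeasure_funpow_vimage:
  assumes "A \<in> sets M"
  shows "emeasure M {x \<in> space M. (T ^^ n) x \<in> A} = emeasure M A"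
proof (induction n)
  case 0
  show ?case using sets.sets_into_space[OF assms] by (simp add: Int_absorb1 Collect_conj_eq)
next
  case (Suc n)
  have B: "{x \<in> space M. (T ^^ n) x \<in> A} \<in> sets M"
    using measurable_sets[OF measurable_funpow assms, of n] by (simp add: vimage_def Int_def conj_commute)
  have "{x \<in> space M. (T ^^ Suc n) x \<in> A} = T -` {x \<in> space M. (T ^^ n) x \<in> A} \<inter> space M"
    using measurable_space[OF measurable_T] by (auto simp: funpow_swap1)
  then show ?case using preserving[OF B] Suc by simp
qed

lemma distr_funpow: "distr M M (T ^^ n) = M"
proof (rule measure_eqI)
  fix A assume "A \<in> sets (distr M M (T ^^ n))"
  then have A: "A \<in> sets M" by simp
  show "emeasure (distr M M (T ^^ n)) A = emeasure M A"
    using emeasure_funpow_vimage[OF A, of n] 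
    by (subst emeasure_distr[OF measurable_funpow A]) (simp add: vimage_def Int_def conj_commute)
qed simp

lemma measurable_hitting_time:
  assumes A: "A \<in> sets M"
  shows "hitting_time T A \<in> measurable M (count_space UNIV)"
proof -
  have [measurable]: "T ^^ n \<in> measurable M M" for n by (rule measurable_funpow)
  note A [measurable]
  show ?thesis unfolding hitting_time_def[abs_def] by measurable
qed

end

section \<open>Recurrence and estimates for hitting times\<close>

context invertible_ergodic_system
begin

text \<open>\<open>B m\<close> collects the points that visit \<open>A\<close> at some time at least
  \<open>m\<close>. It is the preimage of \<open>B 0\<close> under \<open>T ^^ m\<close>, so all
  these sets have the same measure, and so has their intersection. The intersection is used because
  ergodicity is stated for exactly invariant sets, whereas \<open>B 0\<close> only contains its own
  preimage.\<close>

lemma AE_hits: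
  assumes A: "A \<in> sets M" "0 < emeasure M A"
  shows "AE x in M. \<exists>n. (T ^^ n) x \<in> A"
proof -
  have [measurable]: "T ^^ n \<in> measurable M M" for n by (rule measurable_funpow)
  note A(1) [measurable]
  define B where "B m = {x \<in> space M. \<exists>n\<ge>m. (T ^^ n) x \<in> A}" for m
  have Bm: "B m \<in> sets M" for m unfolding B_def by measurable
  have dec: "decseq B" by (auto simp: B_def decseq_def intro: order_trans)
  have sp: "(T ^^ n) x \<in> space M" if "x \<in> space M" for n x
    using measurable_space[OF measurable_funpow that] .
  have Beq: "B m = {x \<in> space M. (T ^^ m) x \<in> B 0}" for m
    using sp by (auto simp: B_def funpow_add[symmetric, THEN fun_cong, simplified])
       (metis add.commute le_add_diff_inverse le_iff_add)+
  have "prob (B m) = prob (B 0)" for m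
    using emeasure_funpow_vimage[OF Bm[of 0], of m] unfolding Beq[of m, symmetric] by (simp add: measure_def)
  moreover have "(\<lambda>m. prob (B m)) \<longlonglongrightarrow> prob (\<Inter>m. B m)"
    using Bm dec by (intro finite_Lim_measure_decseq) auto
  ultimately have "(\<lambda>m. prob (B 0)) \<longlonglongrightarrow> prob (\<Inter>m. B m)" by (rule subst[where P = "\<lambda>f. f \<longlonglongrightarrow> _", OF ext])
  then have pL: "prob (\<Inter>m. B m) = prob (B 0)"
    by (simp add: LIMSEQ_const_iff)
  have "A \<subseteq> B 0" using sets.sets_into_space[OF A(1)] by (auto simp: B_def intro: exI[of _ 0])
  then have "prob A \<le> prob (B 0)" using Bm by (intro finite_measure_mono) auto
  moreover have "0 < prob A" using A(2) by (simp add: emeasure_eq_measure)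
  ultimately have pos: "prob (\<Inter>m. B m) \<noteq> 0" using pL by simp
  have inv: "T -` (\<Inter>m. B m) \<inter> space M = (\<Inter>m. B m)"
  proof (intro set_eqI iffI)
    fix x assume x: "x \<in> T -` (\<Inter>m. B m) \<inter> space M"
    have "\<exists>n\<ge>m. (T ^^ n) x \<in> A" for m
    proof -
      have "T x \<in> B m" using x by auto
      then obtain n where "n \<ge> m" "(T ^^ n) (T x) \<in> A" by (auto simp: B_def)
      then show ?thesis by (intro exI[of _ "Suc n"]) (simp add: funpow_swap1)
    qed
    then show "x \<in> (\<Inter>m. B m)" using x by (auto simp: B_def)
  next
    fix x assume x: "x \<in> (\<Inter>m. B m)"
    have xs: "x \<in> space M" using x by (auto simp: B_def)
    have "\<exists>n\<ge>m. (T ^^ n) (T x) \<in> A" for m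
    proof -
      have "x \<in> B (Suc m)" using x by auto
      then obtain n where n: "n \<ge> Suc m" "(T ^^ n) x \<in> A" by (auto simp: B_def)
      then obtain n' where "n = Suc n'" "n' \<ge> m" by (cases n) auto
      then show ?thesis using n by (intro exI[of _ n']) (simp add: funpow_swap1)
    qed
    then show "x \<in> T -` (\<Inter>m. B m) \<inter> space M"
      using xs measurable_space[OF measurable_T xs] by (auto simp: B_def)
  qed
  have "(\<Inter>m. B m) \<in> sets M" using Bm by auto
  from ergodic[OF this inv] pos have "prob (\<Inter>m. B m) = 1" by simp
  then have "AE x in M. x \<in> (\<Inter>m. B m)" using Bm by (subst (asm) prob_eq_1) auto
  then show ?thesis by eventually_elim (auto simp: B_def)
qed

text \<open>Up to a null set, where the hitting time is unspecified, the event lies in the preimage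
  of \<open>A\<close> under \<open>T ^^ n\<close>, which has the measure of
  \<open>A\<close>.\<close>

lemma emeasure_hitting_time_eq:
  assumes A: "A \<in> sets M" "0 < emeasure M A"
  shows "emeasure M {x \<in> space M. hitting_time T A x = n} \<le> emeasure M A"
proof -
  have [measurable]: "T ^^ n \<in> measurable M M" for n by (rule measurable_funpow)
  note A(1) [measurable]
  have "emeasure M {x \<in> space M. hitting_time T A x = n} \<le> emeasure M {x \<in> space M. (T ^^ n) x \<in> A}"
  proof (rule emeasure_mono_AE)
    show "AE x in M. x \<in> {x \<in> space M. hitting_time T A x = n} \<longrightarrow> x \<in> {x \<in> space M. (T ^^ n) x \<in> A}"
      using AE_hits[OF A] by eventually_elim (auto simp: hitting_time_def intro: LeastI)
  qed measurable
  then show ?thesis using emeasure_funpow_vimage[OF A(1)] by simp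
qed

lemma emeasure_hitting_time_in:
  assumes A: "A \<in> sets M" "0 < emeasure M A" and S: "finite S"
  shows "emeasure M {x \<in> space M. hitting_time T A x \<in> S} \<le> of_nat (card S) * emeasure M A"
proof -
  note measurable_hitting_time[OF A(1), measurable]
  have "{x \<in> space M. hitting_time T A x \<in> S} = (\<Union>n\<in>S. {x \<in> space M. hitting_time T A x = n})" by auto
  also have "emeasure M \<dots> \<le> (\<Sum>n\<in>S. emeasure M {x \<in> space M. hitting_time T A x = n})"
    using S by (intro emeasure_subadditive_finite) (auto intro!: measurable)
  also have "\<dots> \<le> (\<Sum>n\<in>S. emeasure M A)" by (intro sum_mono emeasure_hitting_time_eq A)
  finally show ?thesis by simp
qed

text \<open>Outside of this set, the hitting times along the first N steps of the two orbits are
  pairwise distinct, within each orbit and across the two.\<close>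

definition close_pairs :: "'a set \<Rightarrow> nat \<Rightarrow> ('a \<times> 'a) set" where
  "close_pairs A N = {p \<in> space (M \<Otimes>\<^sub>M M).
     hitting_time T A (fst p) < N \<or> hitting_time T A (snd p) < N \<or>
     hitting_time T A (fst p) \<le> hitting_time T A (snd p) + N \<and>
     hitting_time T A (snd p) \<le> hitting_time T A (fst p) + N}"

lemma sets_close_pairs:
  assumes "A \<in> sets M"
  shows "close_pairs A N \<in> sets (M \<Otimes>\<^sub>M M)"
proof -
  have [measurable]: "(\<lambda>x. real (hitting_time T A x)) \<in> borel_measurable M"
    by (rule measurable_compose[OF measurable_hitting_time[OF assms]]) simp
  have "{p \<in> space (M \<Otimes>\<^sub>M M).
     real (hitting_time T A (fst p)) < real N \<or> real (hitting_time T A (snd p)) < real N \<or>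
     real (hitting_time T A (fst p)) \<le> real (hitting_time T A (snd p)) + real N \<and>
     real (hitting_time T A (snd p)) \<le> real (hitting_time T A (fst p)) + real N} \<in> sets (M \<Otimes>\<^sub>M M)"
    by measurable
  then show ?thesis unfolding close_pairs_def by (simp flip: of_nat_add)
qed

text \<open>The first point has hitting time below \<open>N\<close> with probability at most
  \<open>N\<close> times the measure of \<open>A\<close>. Otherwise the second hitting time is
  confined to \<open>N\<close> small values or to \<open>2 * N + 1\<close> values around the first
  one, each of probability at most the measure of \<open>A\<close>.\<close>

lemma emeasure_close_pairs:
  assumes A: "A \<in> sets M" "0 < emeasure M A"
  shows "emeasure (M \<Otimes>\<^sub>M M) (close_pairs A N) \<le> of_nat (4 * N + 1) * emeasure M A"
proof -
  note measurable_hitting_time[OF A(1), measurable]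
  have "emeasure (M \<Otimes>\<^sub>M M) (close_pairs A N) = (\<integral>\<^sup>+x. emeasure M (Pair x -` close_pairs A N) \<partial>M)"
    by (rule emeasure_pair_measure_alt[OF sets_close_pairs[OF A(1)]])
  also have "\<dots> \<le> (\<integral>\<^sup>+x. indicator {x \<in> space M. hitting_time T A x \<in> {..<N}} x 
       + of_nat (3 * N + 1) * emeasure M A \<partial>M)"
  proof (rule nn_integral_mono)
    fix x assume x: "x \<in> space M"
    show "emeasure M (Pair x -` close_pairs A N)
        \<le> indicator {x \<in> space M. hitting_time T A x \<in> {..<N}} x + of_nat (3 * N + 1) * emeasure M A"
    proof (cases "hitting_time T A x < N")
      case True
      have "emeasure M (Pair x -` close_pairs A N) \<le> 1" by (rule emeasure_le_1)
      then show ?thesis using True x by (simp add: add_increasing2)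
    next
      case False
      let ?S = "{..<N} \<union> {hitting_time T A x - N..hitting_time T A x + N}"
      have "card ?S \<le> card {..<N} + card {hitting_time T A x - N..hitting_time T A x + N}" by (rule card_Un_le)
      also have "\<dots> \<le> 3 * N + 1" by simp
      finally have c: "card ?S \<le> 3 * N + 1" .
      have "emeasure M (Pair x -` close_pairs A N) \<le> emeasure M {y \<in> space M. hitting_time T A y \<in> ?S}"
        using False by (intro emeasure_mono) (auto simp: close_pairs_def space_pair_measure)
      also have "\<dots> \<le> of_nat (card ?S) * emeasure M A" by (intro emeasure_hitting_time_in A) auto
      also have "\<dots> \<le> of_nat (3 * N + 1) * emeasure M A" using c by (intro mult_right_mono of_nat_mono) auto
      finally show ?thesis by (simp add: add_increasing)
    qed
  qed
  also have "\<dots> = emeasure M {x \<in> space M. hitting_time T A x \<in> {..<N}} + of_nat (3 * N + 1) * emeasure M A"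
    by (subst nn_integral_add) (auto simp: emeasure_space_1)
  also have "\<dots> \<le> of_nat (card {..<N}) * emeasure M A + of_nat (3 * N + 1) * emeasure M A"
    by (intro add_right_mono emeasure_hitting_time_in A) auto
  also have "\<dots> = of_nat (card {..<N} + (3 * N + 1)) * emeasure M A"
    by (simp only: of_nat_add distrib_right)
  also have "card {..<N} + (3 * N + 1) = 4 * N + 1" by simp
  finally show ?thesis .
qed

end

section \<open>Noise read off along an orbit\<close>

context invertible_ergodic_system
begin

definition coded_noise :: "(nat \<Rightarrow> 'a set) \<Rightarrow> (nat \<times> nat \<Rightarrow> real) \<Rightarrow> 'a \<Rightarrow> real" where
  "coded_noise A \<theta> x = noise_series \<theta> (\<lambda>j. hitting_time T (A j) x)"

text \<open>Joint measurability is what allows the integrals over noise and space to be exchanged.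
  The noise is evaluated at a random index, which is harmless because hitting times take countably
  many values.\<close>

lemma measurable_coded_noise:
  assumes A: "\<And>j. A j \<in> sets M"
  shows "(\<lambda>w. coded_noise A (fst w) (snd w)) \<in> borel_measurable (noise \<Otimes>\<^sub>M M)"
proof -
  have "(\<lambda>w. fst w (j, hitting_time T (A j) (snd w))) \<in> borel_measurable ((noise :: (nat \<times> nat \<Rightarrow> real) measure) \<Otimes>\<^sub>M M)" for j
  proof (rule measurable_compose_countable[where f = "\<lambda>i w. fst w (j, i)"])
    show "(\<lambda>w. fst w (j, i)) \<in> borel_measurable ((noise :: (nat \<times> nat \<Rightarrow> real) measure) \<Otimes>\<^sub>M M)" for i :: nat
      by (rule measurable_compose[OF measurable_fst measurable_noise_component])
    show "(\<lambda>w. hitting_time T (A j) (snd w)) \<in> measurable (noise \<Otimes>\<^sub>M M) (count_space UNIV)"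
      by (rule measurable_compose[OF measurable_snd measurable_hitting_time[OF A]])
  qed
  then show ?thesis unfolding coded_noise_def noise_series_def by measurable
qed

text \<open>Let \<open>J\<close> be the first level at which the pair is not close. There the labels
  along both orbits are distinct and disjoint, which gives the bound
  \<open>(2 ^ (J + 2) * (1/2) ^ m) ^ card K\<close>. As \<open>J\<close> depends on the pair, its
  power is dominated by a sum over the levels where the pair is close, a quantity that can be
  integrated.\<close>

lemma collision_probability:
  fixes g :: "'k \<Rightarrow> nat"
  assumes K: "finite K" and g: "inj_on g K" "\<And>k. k \<in> K \<Longrightarrow> g k \<le> N"
    and xy: "x \<in> space M" "y \<in> space M"
    and hits: "\<And>j. \<exists>n. (T ^^ n) x \<in> A j" "\<And>j. \<exists>n. (T ^^ n) y \<in> A j"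
  shows "emeasure noise {\<theta>. \<forall>k\<in>K. \<bar>coded_noise A \<theta> ((T ^^ g k) x) - coded_noise A \<theta> ((T ^^ g k) y)\<bar> < (1/2) ^ m}
    \<le> ennreal ((1/2) ^ (m * card K) * 4 ^ card K) *
       (1 + (\<Sum>j. ennreal ((2 ^ card K) ^ Suc j) * indicator (close_pairs (A j) N) (x, y)))"
    (is "?P \<le> ?c * (1 + (\<Sum>j. ?t j))")
proof (cases "\<exists>j. (x, y) \<notin> close_pairs (A j) N")
  case True
  define J where "J = (LEAST j. (x, y) \<notin> close_pairs (A j) N)"
  have J: "(x, y) \<notin> close_pairs (A J) N" unfolding J_def using True by (rule LeastI_ex)
  have below: "(x, y) \<in> close_pairs (A j) N" if "j < J" for j
    using not_less_Least[of j] that unfolding J_def by blast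
  let ?r = "\<lambda>j. hitting_time T (A j)"
  \<comment> \<open>Since every \<open>g k\<close> is at most \<open>N\<close>, the shifts neither
    pass the first visit nor close the gap between the two hitting times.\<close>
  have far: "N \<le> ?r J x" "N \<le> ?r J y" "?r J x > ?r J y + N \<or> ?r J y > ?r J x + N"
    using J xy by (auto simp: close_pairs_def space_pair_measure not_less)
  have shift: "?r J ((T ^^ g k) x) = ?r J x - g k" "?r J ((T ^^ g k) y) = ?r J y - g k" if "k \<in> K" for k
    using hits[of J] far g(2)[OF that] by (auto intro!: hitting_time_iterate)
  have "?P \<le> ennreal (2 * (1/2) ^ m * 2 ^ Suc J) ^ card K"
    unfolding coded_noise_def
  proof (rule noise_series_collision[OF K])
    show "inj_on (\<lambda>k. ?r J ((T ^^ g k) x)) K"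
    proof (rule inj_onI)
      fix k l assume kl: "k \<in> K" "l \<in> K" "?r J ((T ^^ g k) x) = ?r J ((T ^^ g l) x)"
      then have "g k = g l" using shift far g(2)[OF kl(1)] g(2)[OF kl(2)] by simp
      then show "k = l" using g(1) kl by (auto dest: inj_onD)
    qed
    fix k l assume kl: "k \<in> K" "l \<in> K"
    then show "?r J ((T ^^ g l) x) \<noteq> ?r J ((T ^^ g k) y)" 
      using shift far g(2)[OF kl(1)] g(2)[OF kl(2)] by auto
  qed simp
  also have "\<dots> = ennreal ((1/2) ^ (m * card K) * 4 ^ card K * (2 ^ card K) ^ J)"
  proof -
    have "2 * (1/2) ^ m * 2 ^ Suc J = (1/2) ^ m * 4 * (2 ^ J :: real)" by simp
    then have "(2 * (1/2) ^ m * 2 ^ Suc J :: real) ^ card K = ((1/2) ^ m * 4 * 2 ^ J) ^ card K" by (rule arg_cong)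
    also have "\<dots> = (1/2) ^ (m * card K) * 4 ^ card K * (2 ^ card K) ^ J"
      by (simp only: power_mult_distrib power_mult[symmetric] mult.commute[of J])
    finally show ?thesis by (subst ennreal_power) (auto simp del: power_Suc)
  qed
  also have "\<dots> = ?c * ennreal ((2 ^ card K) ^ J)" by (rule ennreal_mult) auto
  also have "\<dots> \<le> ?c * (1 + (\<Sum>j. ?t j))"
  proof (rule mult_left_mono)
    \<comment> \<open>If \<open>J = Suc I\<close>, the pair is close at level \<open>I\<close>, and
      the exponent \<open>Suc I\<close> of that term is exactly \<open>J\<close>. The summand 1
      covers \<open>J = 0\<close>.\<close>
    show "ennreal ((2 ^ card K) ^ J) \<le> 1 + (\<Sum>j. ?t j)"
    proof (cases J)
      case (Suc I)
      have "sum ?t {I} \<le> (\<Sum>j. ?t j)" by (rule sum_le_suminf) auto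
      then have "ennreal ((2 ^ card K) ^ J) \<le> (\<Sum>j. ?t j)" using below[of I] Suc by simp
      then show ?thesis by (rule order_trans) simp
    qed simp
  qed simp
  finally show ?thesis .
next
  case False
  \<comment> \<open>No level separates the two orbits, so every term is at least 1 and the series is infinite.\<close>
  have "of_nat n \<le> (\<Sum>j. ?t j)" for n
  proof -
    have "(1::ennreal) \<le> ?t j" for j
      using False by (simp add: one_le_power del: power_Suc)
    then have "(\<Sum>j<n. 1) \<le> (\<Sum>j<n. ?t j)" by (intro sum_mono)
    also have "\<dots> \<le> (\<Sum>j. ?t j)" by (rule sum_le_suminf) auto
    finally show ?thesis by simp
  qed
  then have "(\<Sum>j. ?t j) = \<top>"
    using ennreal_SUP_of_nat_eq_top SUP_least[of UNIV of_nat "\<Sum>j. ?t j"] by (metis top_unique)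
  then show ?thesis by (simp add: ennreal_mult_top)
qed

lemma AE_hits_pair:
  assumes A: "\<And>j::nat. A j \<in> sets M" "\<And>j. 0 < emeasure M (A j)"
  shows "AE p in M \<Otimes>\<^sub>M M. \<forall>j. (\<exists>n. (T ^^ n) (fst p) \<in> A j) \<and> (\<exists>n. (T ^^ n) (snd p) \<in> A j)"
proof -
  interpret pair_prob_space M M ..
  have [measurable]: "T ^^ n \<in> measurable M M" for n by (rule measurable_funpow)
  note A(1) [measurable]
  have all: "AE x in M. \<forall>j. \<exists>n. (T ^^ n) x \<in> A j"
    using AE_hits[OF A] by (simp add: AE_all_countable)
  show ?thesis
  proof (rule AE_pair_measure)
    show "AE x in M. AE y in M. \<forall>j. (\<exists>n. (T ^^ n) (fst (x, y)) \<in> A j) \<and> (\<exists>n. (T ^^ n) (snd (x, y)) \<in> A j)"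
      using all
    proof eventually_elim
      case (elim x)
      from all show ?case by eventually_elim (use elim in auto)
    qed
  qed measurable
qed

text \<open>Integrating the pointwise bound gives a multiple of an exponential series in
  \<open>2 ^ card K\<close>. The factorial decay of the measures of \<open>A j\<close> makes it
  converge for every \<open>K\<close>, so one choice of sets serves all dimensions. The constant
  does not depend on \<open>m\<close>.\<close>

lemma collision_integral:
  fixes g :: "'k \<Rightarrow> nat"
  assumes A: "\<And>j. A j \<in> sets M" "\<And>j. 0 < emeasure M (A j)" "\<And>j. emeasure M (A j) \<le> ennreal (1 / fact j)"
    and K: "finite K" and g: "inj_on g K"
  obtains C where "0 \<le> C" "\<And>m. (\<integral>\<^sup>+p. emeasure noise {\<theta>. \<forall>k\<in>K. \<bar>coded_noise A \<theta> ((T ^^ g k) (fst p))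
      - coded_noise A \<theta> ((T ^^ g k) (snd p))\<bar> < (1/2) ^ m} \<partial>(M \<Otimes>\<^sub>M M)) \<le> ennreal ((1/2) ^ (m * card K) * C)"
proof -
  interpret MM: pair_prob_space M M ..
  define N where "N = sum g K"
  have gN: "g k \<le> N" if "k \<in> K" for k unfolding N_def using K that by (simp add: member_le_sum)
  define q :: real where "q = 2 ^ card K"
  define c where "c j = q ^ Suc j * (real (4 * N + 1) * (1 / fact j))" for j
  have c0: "0 \<le> c j" for j by (simp add: c_def q_def)
  have sc: "summable c"
  proof -
    have "summable (\<lambda>j. (q * real (4 * N + 1)) * (inverse (fact j) * q ^ j))"
      by (intro summable_mult summable_exp)
    then show ?thesis by (simp add: c_def[abs_def] field_simps)
  qed
  have cp [measurable]: "close_pairs (A j) N \<in> sets (M \<Otimes>\<^sub>M M)" for j by (rule sets_close_pairs[OF A(1)])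
  have int: "(\<integral>\<^sup>+p. 1 + (\<Sum>j. ennreal (q ^ Suc j) * indicator (close_pairs (A j) N) p) \<partial>(M \<Otimes>\<^sub>M M)) \<le> ennreal (1 + suminf c)"
  proof -
    have "(\<integral>\<^sup>+p. 1 + (\<Sum>j. ennreal (q ^ Suc j) * indicator (close_pairs (A j) N) p) \<partial>(M \<Otimes>\<^sub>M M))
      = 1 + (\<Sum>j. ennreal (q ^ Suc j) * emeasure (M \<Otimes>\<^sub>M M) (close_pairs (A j) N))"
      by (subst nn_integral_add, simp, simp, subst nn_integral_suminf)
         (simp_all add: nn_integral_cmult MM.P.emeasure_space_1 del: power_Suc)
    also have "(\<Sum>j. ennreal (q ^ Suc j) * emeasure (M \<Otimes>\<^sub>M M) (close_pairs (A j) N)) \<le> (\<Sum>j. ennreal (c j))"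
    proof (rule suminf_le)
      fix j
      have "emeasure (M \<Otimes>\<^sub>M M) (close_pairs (A j) N) \<le> of_nat (4 * N + 1) * emeasure M (A j)"
        by (rule emeasure_close_pairs[OF A(1,2)])
      also have "\<dots> \<le> of_nat (4 * N + 1) * ennreal (1 / fact j)" by (intro mult_left_mono A) simp
      also have "\<dots> = ennreal (real (4 * N + 1) * (1 / fact j))"
        by (subst ennreal_mult) (auto simp: ennreal_of_nat_eq_real_of_nat)
      finally have "ennreal (q ^ Suc j) * emeasure (M \<Otimes>\<^sub>M M) (close_pairs (A j) N)
          \<le> ennreal (q ^ Suc j) * ennreal (real (4 * N + 1) * (1 / fact j))" by (rule mult_left_mono) simp
      also have "\<dots> = ennreal (c j)" unfolding c_def
        by (rule ennreal_mult[symmetric]) (auto simp: q_def)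
      finally show "ennreal (q ^ Suc j) * emeasure (M \<Otimes>\<^sub>M M) (close_pairs (A j) N) \<le> ennreal (c j)" .
    qed auto
    also have "(\<Sum>j. ennreal (c j)) = ennreal (suminf c)" by (rule suminf_ennreal2[OF c0 sc])
    also have "1 + ennreal (suminf c) = ennreal (1 + suminf c)"
      using suminf_nonneg[OF sc c0] by (subst ennreal_plus) auto
    finally show ?thesis by (simp add: add_left_mono)
  qed
  show ?thesis
  proof (rule that[of "4 ^ card K * (1 + suminf c)"])
    show "0 \<le> 4 ^ card K * (1 + suminf c)" using suminf_nonneg[OF sc c0] by simp
    fix m
    let ?h = "\<lambda>p. 1 + (\<Sum>j. ennreal (q ^ Suc j) * indicator (close_pairs (A j) N) p)"
    have "(\<integral>\<^sup>+p. emeasure noise {\<theta>. \<forall>k\<in>K. \<bar>coded_noise A \<theta> ((T ^^ g k) (fst p))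
      - coded_noise A \<theta> ((T ^^ g k) (snd p))\<bar> < (1/2) ^ m} \<partial>(M \<Otimes>\<^sub>M M))
      \<le> (\<integral>\<^sup>+p. ennreal ((1/2) ^ (m * card K) * 4 ^ card K) * ?h p \<partial>(M \<Otimes>\<^sub>M M))"
    proof (rule nn_integral_mono_AE)
      show "AE p in M \<Otimes>\<^sub>M M. emeasure noise {\<theta>. \<forall>k\<in>K. \<bar>coded_noise A \<theta> ((T ^^ g k) (fst p))
        - coded_noise A \<theta> ((T ^^ g k) (snd p))\<bar> < (1/2) ^ m} \<le> ennreal ((1/2) ^ (m * card K) * 4 ^ card K) * ?h p"
        using AE_hits_pair[of A, OF A(1,2)] AE_space[of "M \<Otimes>\<^sub>M M"]
      proof eventually_elim
        case (elim p)
        then show ?case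
          using collision_probability[OF K g gN, of "fst p" "snd p" A m]
          by (auto simp: space_pair_measure q_def simp del: power_Suc)
      qed
    qed
    also have "\<dots> = ennreal ((1/2) ^ (m * card K) * 4 ^ card K) * (\<integral>\<^sup>+p. ?h p \<partial>(M \<Otimes>\<^sub>M M))"
      by (rule nn_integral_cmult) measurable
    also have "\<dots> \<le> ennreal ((1/2) ^ (m * card K) * 4 ^ card K) * ennreal (1 + suminf c)"
      by (intro mult_left_mono int) simp
    also have "\<dots> = ennreal ((1/2) ^ (m * card K) * (4 ^ card K * (1 + suminf c)))"
      using suminf_nonneg[OF sc c0] by (subst ennreal_mult[symmetric]) (auto simp: mult.assoc)
    finally show "(\<integral>\<^sup>+p. emeasure noise {\<theta>. \<forall>k\<in>K. \<bar>coded_noise A \<theta> ((T ^^ g k) (fst p))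
      - coded_noise A \<theta> ((T ^^ g k) (snd p))\<bar> < (1/2) ^ m} \<partial>(M \<Otimes>\<^sub>M M))
      \<le> ennreal ((1/2) ^ (m * card K) * (4 ^ card K * (1 + suminf c)))" .
  qed
qed

end

section \<open>From averaged collisions to almost every noise sample\<close>

text \<open>A finite lower limit \<open>c\<close> excludes that the sequence eventually stays above
  \<open>c + 1\<close>. This turns the outcome of Fatou's lemma into a bound at infinitely many
  levels.\<close>

lemma frequently_le_of_liminf_finite:
  fixes u :: "nat \<Rightarrow> ennreal"
  assumes "liminf u \<noteq> \<infinity>"
  obtains C :: real where "0 \<le> C" "\<exists>\<^sub>F m in sequentially. u m \<le> ennreal C"
proof -
  obtain c where c: "0 \<le> c" "liminf u = ennreal c" using assms by (cases "liminf u") auto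
  have "\<exists>\<^sub>F m in sequentially. u m \<le> ennreal (c + 1)"
  proof (rule ccontr)
    assume "\<not> ?thesis"
    then have "\<forall>\<^sub>F m in sequentially. ennreal (c + 1) \<le> u m"
      unfolding not_frequently by eventually_elim simp
    then have "ennreal (c + 1) \<le> liminf u" by (rule Liminf_bounded)
    then show False using c by (simp add: ennreal_le_iff)
  qed
  then show ?thesis using c by (intro that[of "c + 1"]) auto
qed

lemma dyadic_code_eq_imp_close:
  assumes "dyadic_code K m u = dyadic_code K m v" "k \<in> K"
  shows "\<bar>u k - v k\<bar> < (1/2) ^ m"
proof -
  have "\<lfloor>2 ^ m * u k\<rfloor> = \<lfloor>2 ^ m * v k\<rfloor>" using assms by (auto simp: dyadic_code_def dest: fun_cong[of _ _ k])
  then have "\<bar>2 ^ m * u k - 2 ^ m * v k\<bar> < 1" by linarith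
  also have "2 ^ m * u k - 2 ^ m * v k = 2 ^ m * (u k - v k)" by (simp add: right_diff_distrib)
  finally show ?thesis by (simp add: abs_mult power_divide pos_less_divide_eq mult.commute)
qed

context invertible_ergodic_system
begin

lemma coded_noise_bounds: "coded_noise A \<theta> x \<in> {0..1}"
  unfolding coded_noise_def using noise_series_bounds by simp

lemma borel_measurable_coded_noise:
  assumes "\<And>j. A j \<in> sets M"
  shows "coded_noise A \<theta> \<in> borel_measurable M"
proof -
  have "Pair \<theta> \<in> measurable M (noise \<Otimes>\<^sub>M M)" by (rule measurable_Pair1') (simp add: space_noise)
  from measurable_compose[OF this measurable_coded_noise[OF assms]] show ?thesis by simp
qed

text \<open>The normalised collision probabilities have noise averages bounded uniformly in
  \<open>m\<close>. By Fatou's lemma their lower limit is finite for almost every \<theta>, which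
  yields a bound at infinitely many levels with a constant depending on \<theta>. That is the form
  in which the criterion takes it.\<close>

lemma AE_absolutely_continuous_coded_noise:
  fixes g :: "'k \<Rightarrow> nat"
  assumes A: "\<And>j. A j \<in> sets M" "\<And>j. 0 < emeasure M (A j)" "\<And>j. emeasure M (A j) \<le> ennreal (1 / fact j)"
    and K: "finite K" and g: "inj_on g K"
  shows "AE \<theta> in noise. absolutely_continuous (\<Pi>\<^sub>M k\<in>K. lborel)
    (distr M (\<Pi>\<^sub>M k\<in>K. lborel) (\<lambda>x. \<lambda>k\<in>K. coded_noise A \<theta> ((T ^^ g k) x)))"
proof -
  let ?N = "noise :: (nat \<times> nat \<Rightarrow> real) measure"
  interpret N: prob_space ?N by (rule prob_space_noise)
  interpret MM: pair_prob_space M M ..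
  interpret NM: pair_prob_space ?N "M \<Otimes>\<^sub>M M" ..
  obtain C where C: "0 \<le> C" "\<And>m. (\<integral>\<^sup>+p. emeasure noise {\<theta>. \<forall>k\<in>K. \<bar>coded_noise A \<theta> ((T ^^ g k) (fst p))
      - coded_noise A \<theta> ((T ^^ g k) (snd p))\<bar> < (1/2) ^ m} \<partial>(M \<Otimes>\<^sub>M M)) \<le> ennreal ((1/2) ^ (m * card K) * C)"
    by (rule collision_integral[of A, OF A K g]) (rule that)
  have Tm: "T ^^ n \<in> measurable M M" for n by (rule measurable_funpow)
  define S where "S m = {w \<in> space (?N \<Otimes>\<^sub>M (M \<Otimes>\<^sub>M M)). \<forall>k\<in>K. \<bar>coded_noise A (fst w) ((T ^^ g k) (fst (snd w)))
      - coded_noise A (fst w) ((T ^^ g k) (snd (snd w)))\<bar> < (1/2) ^ m}" for m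
  have at: "(\<lambda>w. coded_noise A (fst w) ((T ^^ n) (h (snd w)))) \<in> borel_measurable (?N \<Otimes>\<^sub>M (M \<Otimes>\<^sub>M M))"
    if "h \<in> measurable (M \<Otimes>\<^sub>M M) M" for n h
  proof -
    have "(\<lambda>w. (fst w, (T ^^ n) (h (snd w)))) \<in> measurable (?N \<Otimes>\<^sub>M (M \<Otimes>\<^sub>M M)) (?N \<Otimes>\<^sub>M M)"
      by (intro measurable_Pair measurable_fst measurable_compose[OF measurable_snd measurable_compose[OF that Tm]])
    from measurable_compose[OF this measurable_coded_noise[OF A(1)]] show ?thesis by simp
  qed
  have S: "S m \<in> sets (?N \<Otimes>\<^sub>M (M \<Otimes>\<^sub>M M))" for m
    unfolding S_def
    by (intro sets.sets_Collect_finite_All K borel_measurable_less borel_measurable_abs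
        borel_measurable_diff at measurable_fst measurable_snd borel_measurable_const)
  \<comment> \<open>The factor cancels the volume of a dyadic cell, so that the averages of
    \<open>f m\<close> have a bound free of \<open>m\<close>.\<close>
  define f where "f m \<theta> = ennreal (2 ^ (m * card K)) * emeasure (M \<Otimes>\<^sub>M M) (Pair \<theta> -` S m)" for m \<theta>
  have fm: "f m \<in> borel_measurable ?N" for m
    unfolding f_def by (intro borel_measurable_times_ennreal borel_measurable_const NM.measurable_emeasure_Pair1 S)
  have fint: "(\<integral>\<^sup>+\<theta>. f m \<theta> \<partial>?N) \<le> ennreal C" for m
  proof -
    have "(\<integral>\<^sup>+\<theta>. f m \<theta> \<partial>?N) = ennreal (2 ^ (m * card K)) * (\<integral>\<^sup>+\<theta>. emeasure (M \<Otimes>\<^sub>M M) (Pair \<theta> -` S m) \<partial>?N)"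
      unfolding f_def by (rule nn_integral_cmult[OF NM.measurable_emeasure_Pair1[OF S]])
    \<comment> \<open>Both iterated integrals compute the measure of \<open>S m\<close>: sections at
      fixed noise become sections at a fixed pair of points, where the collision estimate
      applies.\<close>
    also have "(\<integral>\<^sup>+\<theta>. emeasure (M \<Otimes>\<^sub>M M) (Pair \<theta> -` S m) \<partial>?N) = emeasure (?N \<Otimes>\<^sub>M (M \<Otimes>\<^sub>M M)) (S m)"
      by (rule MM.P.emeasure_pair_measure_alt[OF S, symmetric])
    also have "\<dots> = (\<integral>\<^sup>+p. emeasure ?N ((\<lambda>\<theta>. (\<theta>, p)) -` S m) \<partial>(M \<Otimes>\<^sub>M M))"
      by (rule NM.emeasure_pair_measure_alt2[OF S])
    also have "\<dots> = (\<integral>\<^sup>+p. emeasure noise {\<theta>. \<forall>k\<in>K. \<bar>coded_noise A \<theta> ((T ^^ g k) (fst p))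
      - coded_noise A \<theta> ((T ^^ g k) (snd p))\<bar> < (1/2) ^ m} \<partial>(M \<Otimes>\<^sub>M M))"
      by (intro nn_integral_cong arg_cong[where f = "emeasure ?N"])
         (auto simp: S_def space_pair_measure space_noise)
    also have "ennreal (2 ^ (m * card K)) * \<dots> \<le> ennreal (2 ^ (m * card K)) * ennreal ((1/2) ^ (m * card K) * C)"
      by (intro mult_left_mono C) simp
    also have "\<dots> = ennreal (2 ^ (m * card K) * ((1/2) ^ (m * card K) * C))"
      using C(1) by (intro ennreal_mult[symmetric]) auto
    also have "2 ^ (m * card K) * ((1/2) ^ (m * card K) * C) = C" by (simp add: power_divide)
    finally show ?thesis .
  qed
  have "(\<integral>\<^sup>+\<theta>. liminf (\<lambda>m. f m \<theta>) \<partial>?N) \<le> liminf (\<lambda>m. \<integral>\<^sup>+\<theta>. f m \<theta> \<partial>?N)"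
    by (rule nn_integral_liminf[OF fm])
  also have "\<dots> \<le> liminf (\<lambda>m. ennreal C)"
    by (intro Liminf_mono always_eventually allI fint)
  also have "\<dots> = ennreal C" by (simp add: Liminf_const)
  finally have "(\<integral>\<^sup>+\<theta>. liminf (\<lambda>m. f m \<theta>) \<partial>?N) \<noteq> \<infinity>" by (auto simp: top_unique)
  then have "AE \<theta> in ?N. liminf (\<lambda>m. f m \<theta>) \<noteq> \<infinity>"
    by (intro nn_integral_PInf_AE borel_measurable_liminf fm)
  then show ?thesis
  proof eventually_elim
    case (elim \<theta>)
    then obtain D where D: "0 \<le> D" "\<exists>\<^sub>F m in sequentially. f m \<theta> \<le> ennreal D"
      by (rule frequently_le_of_liminf_finite)
    define V where "V x = (\<lambda>k\<in>K. coded_noise A \<theta> ((T ^^ g k) x))" for x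
    have Vm: "V \<in> measurable M (\<Pi>\<^sub>M k\<in>K. lborel)"
      unfolding V_def
      by (rule measurable_restrict) (use measurable_compose[OF Tm borel_measurable_coded_noise[OF A(1)]] in simp)
    have "absolutely_continuous (\<Pi>\<^sub>M k\<in>K. lborel) (distr M (\<Pi>\<^sub>M k\<in>K. lborel) V)"
    proof (rule absolutely_continuous_of_collisions[OF prob_space_axioms K Vm, where C = D])
      show "V x k \<in> {0..1}" if "k \<in> K" for x k using that coded_noise_bounds by (simp add: V_def)
      show "\<exists>\<^sub>F m in sequentially. measure (M \<Otimes>\<^sub>M M)
        {p \<in> space (M \<Otimes>\<^sub>M M). dyadic_code K m (V (fst p)) = dyadic_code K m (V (snd p))}
        \<le> D * (1/2) ^ (m * card K)"
        using D(2)
      proof (rule frequently_elim1)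
        fix m assume m: "f m \<theta> \<le> ennreal D"
        have Sm: "Pair \<theta> -` S m \<in> sets (M \<Otimes>\<^sub>M M)" by (rule sets_Pair1[OF S])
        have "measure (M \<Otimes>\<^sub>M M) {p \<in> space (M \<Otimes>\<^sub>M M). dyadic_code K m (V (fst p)) = dyadic_code K m (V (snd p))}
          \<le> measure (M \<Otimes>\<^sub>M M) (Pair \<theta> -` S m)"
        proof (rule MM.P.finite_measure_mono[OF _ Sm], intro subsetI)
          fix p assume p: "p \<in> {p \<in> space (M \<Otimes>\<^sub>M M). dyadic_code K m (V (fst p)) = dyadic_code K m (V (snd p))}"
          then have "\<bar>V (fst p) k - V (snd p) k\<bar> < (1/2) ^ m" if "k \<in> K" for k
            using that by (intro dyadic_code_eq_imp_close) auto
          then show "p \<in> Pair \<theta> -` S m"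
            using p by (auto simp: S_def V_def space_pair_measure[of noise] space_noise)
        qed
        also have "\<dots> \<le> D * (1/2) ^ (m * card K)"
        proof -
          have "ennreal (2 ^ (m * card K) * measure (M \<Otimes>\<^sub>M M) (Pair \<theta> -` S m)) \<le> ennreal D"
            using m unfolding f_def MM.P.emeasure_eq_measure by (simp add: ennreal_mult)
          then have "2 ^ (m * card K) * measure (M \<Otimes>\<^sub>M M) (Pair \<theta> -` S m) \<le> D"
            using D(1) by (simp add: ennreal_le_iff)
          then show ?thesis by (simp add: power_divide pos_le_divide_eq mult.commute)
        qed
        finally show "measure (M \<Otimes>\<^sub>M M)
          {p \<in> space (M \<Otimes>\<^sub>M M). dyadic_code K m (V (fst p)) = dyadic_code K m (V (snd p))}
          \<le> D * (1/2) ^ (m * card K)" .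
      qed
    qed
    then show ?case by (simp add: V_def[abs_def])
  qed
qed

end

section \<open>Integer iterates and the choice of the function\<close>

context invertible_mpt
begin

lemma measurable_int_iterate: "int_iterate M T n \<in> measurable M M"
proof -
  have "inv_into (space M) T ^^ k \<in> measurable M M" for k
  proof (induction k)
    case (Suc k)
    show ?case using measurable_comp[OF Suc measurable_inv] by (simp add: o_def)
  qed (simp add: id_def)
  then show ?thesis using measurable_funpow by (simp add: int_iterate_def)
qed

text \<open>For negative \<open>k\<close>, the inverse steps cancel part of the \<open>s\<close>
  forward steps. The point must lie in \<open>space M\<close>, since only there does
  \<open>inv_into\<close> undo \<open>T\<close>.\<close>

lemma int_iterate_funpow:
  assumes x: "x \<in> space M" and n: "0 \<le> k + int s"
  shows "int_iterate M T k ((T ^^ s) x) = (T ^^ nat (k + int s)) x"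
proof (cases "0 \<le> k")
  case True
  then show ?thesis by (simp add: int_iterate_def nat_add_distrib funpow_add)
next
  case False
  have cancel: "(inv_into (space M) T ^^ p) ((T ^^ p) z) = z" if "z \<in> space M" for p z
    using that
  proof (induction p arbitrary: z)
    case (Suc p)
    have "inv_into (space M) T (T z) = z"
      using Suc(2) bij by (simp add: bij_betw_def inv_into_f_f)
    moreover have "(inv_into (space M) T ^^ Suc p) ((T ^^ Suc p) z)
       = inv_into (space M) T ((inv_into (space M) T ^^ p) ((T ^^ p) (T z)))"
      by (simp add: funpow_swap1)
    ultimately show ?case using Suc.IH[OF measurable_space[OF measurable_T Suc(2)]] by simp
  qed simp
  have "s = nat (- k) + nat (k + int s)" using False n by simp
  then have "(T ^^ s) x = (T ^^ nat (- k)) ((T ^^ nat (k + int s)) x)" by (metis comp_apply funpow_add)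
  then show ?thesis
    using False cancel[OF measurable_space[OF measurable_funpow x]] by (simp add: int_iterate_def)
qed

end

text \<open>Nonatomicity excludes systems such as a cyclic permutation of finitely many points, on
  which every function takes finitely many values and so has a law with atoms.\<close>

theorem proposition2p2:
  fixes M :: "'a measure" and T :: "'a \<Rightarrow> 'a"
  assumes "invertible_ergodic_system M T"
    and "nonatomic M"
  shows "\<exists>F :: 'a \<Rightarrow> real. square_integrable M F \<and>
    absolutely_continuous_process M (UNIV :: int set) (\<lambda>n. F \<circ> int_iterate M T n)"
proof -
  interpret invertible_ergodic_system M T by (rule assms(1))
  interpret N: prob_space "noise :: (nat \<times> nat \<Rightarrow> real) measure" by (rule prob_space_noise)
  have "\<exists>A. A \<in> sets M \<and> 0 < emeasure M A \<and> emeasure M A \<le> ennreal (1 / fact j)" for j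
    by (rule nonatomic_small_set[OF assms(2), of "1 / fact j"]) auto
  then have "\<exists>A. \<forall>j::nat. A j \<in> sets M \<and> 0 < emeasure M (A j) \<and> emeasure M (A j) \<le> ennreal (1 / fact j)"
    by (intro choice allI)
  then obtain A where A: "\<And>j::nat. A j \<in> sets M" "\<And>j. 0 < emeasure M (A j)"
      "\<And>j. emeasure M (A j) \<le> ennreal (1 / fact j)"
    by blast
  \<comment> \<open>The hitting-time estimates concern forward orbits only, so K is first shifted into the
    nonnegative integers, which does not change the joint law.\<close>
  define s where "s K = nat (\<Sum>k\<in>K. \<bar>k\<bar>)" for K :: "int set"
  have s: "0 \<le> k + int (s K)" if "finite K" "k \<in> K" for k K
  proof -
    have "\<bar>k\<bar> \<le> (\<Sum>k\<in>K. \<bar>k\<bar>)" using that by (intro member_le_sum) auto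
    then show ?thesis by (simp add: s_def)
  qed
  \<comment> \<open>There are only countably many finite sets of integers, so a single sample
    \<theta> can be good for all of them.\<close>
  have "AE \<theta> in noise. \<forall>K\<in>Collect (finite :: int set \<Rightarrow> bool). absolutely_continuous (\<Pi>\<^sub>M k\<in>K. lborel)
    (distr M (\<Pi>\<^sub>M k\<in>K. lborel) (\<lambda>x. \<lambda>k\<in>K. coded_noise A \<theta> ((T ^^ nat (k + int (s K))) x)))"
  proof (rule AE_ball_countable')
    fix K :: "int set" assume "K \<in> Collect finite"
    then have K: "finite K" by simp
    have "inj_on (\<lambda>k. nat (k + int (s K))) K"
      using s[OF K] by (auto simp: inj_on_def eq_nat_nat_iff)
    then show "AE \<theta> in noise. absolutely_continuous (\<Pi>\<^sub>M k\<in>K. lborel)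
      (distr M (\<Pi>\<^sub>M k\<in>K. lborel) (\<lambda>x. \<lambda>k\<in>K. coded_noise A \<theta> ((T ^^ nat (k + int (s K))) x)))"
      by (rule AE_absolutely_continuous_coded_noise[OF A K])
  qed (rule countable_Collect_finite)
  from eventually_happens'[OF N.ae_filter_bot this]
  obtain \<theta> where "\<forall>K\<in>Collect (finite :: int set \<Rightarrow> bool). absolutely_continuous (\<Pi>\<^sub>M k\<in>K. lborel)
    (distr M (\<Pi>\<^sub>M k\<in>K. lborel) (\<lambda>x. \<lambda>k\<in>K. coded_noise A \<theta> ((T ^^ nat (k + int (s K))) x)))"
    by (rule exE)
  then have \<theta>: "absolutely_continuous (\<Pi>\<^sub>M k\<in>K. lborel)
    (distr M (\<Pi>\<^sub>M k\<in>K. lborel) (\<lambda>x. \<lambda>k\<in>K. coded_noise A \<theta> ((T ^^ nat (k + int (s K))) x)))"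
    if "finite K" for K :: "int set"
    by (rule bspec) (use that in simp)
  define F where "F = coded_noise A \<theta>"
  have Fm: "F \<in> borel_measurable M" unfolding F_def by (rule borel_measurable_coded_noise[OF A(1)])
  have F01: "0 \<le> F x" "F x \<le> 1" for x using coded_noise_bounds[of A \<theta> x] by (auto simp: F_def)
  have proc: "F \<circ> int_iterate M T n \<in> borel_measurable M" for n
    by (rule measurable_comp[OF measurable_int_iterate Fm])
  have "square_integrable M F"
    unfolding square_integrable_def
  proof
    show "integrable M (\<lambda>x. (F x)\<^sup>2)"
      using Fm F01 by (intro integrable_const_bound[where B = 1]) (auto simp: power_le_one)
  qed (rule Fm)
  moreover have "absolutely_continuous_process M (UNIV :: int set) (\<lambda>n. F \<circ> int_iterate M T n)"
    unfolding absolutely_continuous_process_def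
  proof (intro conjI ballI allI impI)
    fix K :: "int set" assume "finite K \<and> K \<subseteq> UNIV"
    then have K: "finite K" by simp
    let ?L = "\<Pi>\<^sub>M k\<in>K. lborel :: real measure"
    let ?V = "\<lambda>x. \<lambda>k\<in>K. (F \<circ> int_iterate M T k) x"
    have V: "?V \<in> measurable M ?L"
      using proc by (intro measurable_restrict) (simp add: o_def)
    \<comment> \<open>Invariance of \<open>M\<close> under \<open>T ^^ s K\<close> replaces each
      exponent \<open>k\<close> by the nonnegative \<open>k + int (s K)\<close>.\<close>
    have "distr M ?L ?V = distr (distr M M (T ^^ s K)) ?L ?V" by (simp add: distr_funpow)
    also have "\<dots> = distr M ?L (?V \<circ> (T ^^ s K))" by (rule distr_distr[OF V measurable_funpow])
    also have "\<dots> = distr M ?L (\<lambda>x. \<lambda>k\<in>K. F ((T ^^ nat (k + int (s K))) x))"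
      by (intro distr_cong refl) (auto simp: int_iterate_funpow s[OF K])
    finally show "absolutely_continuous ?L (distr M ?L ?V)"
      using \<theta>[OF K] by (simp add: F_def)
  qed (use proc in auto)
  ultimately show ?thesis by blast
qed

end
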